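(* Let $G$ be a group that is hyperbolic relative to a collection of subgroups. Let $N \subseteq G$ be a finitely generated subgroup containing a loxodromic element $w$. Suppose $tNt^{-1} \subseteq N$ for some infinite order element $t \in G$ with $\langle t \rangle \cap N = \{1_G\}$. Then $G$ fails to have the finitely generated intersection property. In particular, there exists an integer $m$ such that $\langle t^m, w^m \rangle \cap N$ is not finitely generated.
   Context: A group has the finitely generated intersection property (FGIP) if the intersection of any two of its finitely generated subgroups is also finitely generated. Relative hyperbolicity is in the standard sense (as in Bowditch), so that $G$ acts as a convergence group on its (Bowditch) boundary $\partial G$. An element is loxodromic if it has infinite order and has exactly two fixed points in $\partial G$; equivalently, it has infinite order and is not conjugate into any of the peripheral subgroups. *)

theory Defs
  imports "HOL-Analysis.Analysis" "HOL-Algebra.Algebra"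
begin

section \<open>Finite generation and the FGIP\<close>

definition finitely_generated :: "('g, 'm) monoid_scheme \<Rightarrow> 'g set \<Rightarrow> bool" where
  "finitely_generated G H \<longleftrightarrow>
     subgroup H G \<and> (\<exists>S. finite S \<and> S \<subseteq> carrier G \<and> generate G S = H)"

definition FGIP :: "('g, 'm) monoid_scheme \<Rightarrow> bool" where
  "FGIP G \<longleftrightarrow>
     (\<forall>H K. finitely_generated G H \<longrightarrow> finitely_generated G K \<longrightarrow> finitely_generated G (H \<inter> K))"

section \<open>Proper hyperbolic spaces and their Gromov boundary\<close>

definition proper_space :: "'x::metric_space itself \<Rightarrow> bool" where
  "proper_space _ \<longleftrightarrow> (\<forall>(x::'x) r. compact (cball x r))"

definition geodesic_space :: "'x::metric_space itself \<Rightarrow> bool" where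
  "geodesic_space _ \<longleftrightarrow>
     (\<forall>x y::'x. \<exists>c::real \<Rightarrow> 'x. c 0 = x \<and> c (dist x y) = y \<and>
        (\<forall>s\<in>{0..dist x y}. \<forall>t\<in>{0..dist x y}. dist (c s) (c t) = \<bar>s - t\<bar>))"

definition gromov_product :: "'x::metric_space \<Rightarrow> 'x \<Rightarrow> 'x \<Rightarrow> real" where
  "gromov_product e x y = (dist e x + dist e y - dist x y) / 2"

definition hyperbolic_space :: "'x::metric_space itself \<Rightarrow> bool" where
  "hyperbolic_space _ \<longleftrightarrow>
     (\<exists>\<delta>::real. \<forall>e x y z::'x.
        gromov_product e x z \<ge> min (gromov_product e x y) (gromov_product e y z) - \<delta>)"

text \<open>Changing the base point changes Gromov products by a bounded amount only, so the quantifiers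
  over all base points below could equally be replaced by one fixed base point.\<close>

definition converges_at_infinity :: "(nat \<Rightarrow> 'x::metric_space) \<Rightarrow> bool" where
  "converges_at_infinity u \<longleftrightarrow>
     (\<forall>e. filterlim (\<lambda>(m, n). gromov_product e (u m) (u n)) at_top (sequentially \<times>\<^sub>F sequentially))"

definition boundary_rel :: "((nat \<Rightarrow> 'x::metric_space) \<times> (nat \<Rightarrow> 'x)) set" where
  "boundary_rel = {(u, v). converges_at_infinity u \<and> converges_at_infinity v \<and>
     (\<forall>e. filterlim (\<lambda>n. gromov_product e (u n) (v n)) at_top sequentially)}"

text \<open>A boundary point is an equivalence class of sequences converging at infinity.\<close>

definition gromov_boundary :: "(nat \<Rightarrow> 'x::metric_space) set set" where
  "gromov_boundary = {u. converges_at_infinity u} // boundary_rel"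

definition boundary_product ::
    "'x::metric_space \<Rightarrow> (nat \<Rightarrow> 'x) set \<Rightarrow> (nat \<Rightarrow> 'x) set \<Rightarrow> ereal" where
  "boundary_product e \<xi> \<eta> =
     (SUP (u, v)\<in>\<xi> \<times> \<eta>. Liminf (sequentially \<times>\<^sub>F sequentially)
        (\<lambda>(m, n). ereal (gromov_product e (u m) (v n))))"

text \<open>The usual topology on the boundary: the sets of all \<open>\<eta>\<close> with \<open>(\<xi>|\<eta>) \<ge> K\<close>, for real
  \<open>K\<close>, form a basis of (not necessarily open) neighbourhoods of \<open>\<xi>\<close>.\<close>

definition boundary_open :: "(nat \<Rightarrow> 'x::metric_space) set set \<Rightarrow> bool" where
  "boundary_open U \<longleftrightarrow> U \<subseteq> gromov_boundary \<and>
     (\<forall>\<xi>\<in>U. \<forall>e. \<exists>K::real. \<forall>\<eta>\<in>gromov_boundary. boundary_product e \<xi> \<eta> \<ge> ereal K \<longrightarrow> \<eta> \<in> U)"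

definition boundary_topology :: "(nat \<Rightarrow> 'x::metric_space) set topology" where
  "boundary_topology = topology boundary_open"

lemma istopology_boundary_open: "istopology boundary_open"
  unfolding istopology_def
proof (intro conjI allI impI)
  fix S T :: "(nat \<Rightarrow> 'a) set set"
  assume S: "boundary_open S" and T: "boundary_open T"
  show "boundary_open (S \<inter> T)"
    unfolding boundary_open_def
  proof (intro conjI ballI allI)
    show "S \<inter> T \<subseteq> gromov_boundary" using S by (auto simp: boundary_open_def)
  next
    fix \<xi> :: "(nat \<Rightarrow> 'a) set" and e :: 'a assume \<xi>: "\<xi> \<in> S \<inter> T"
    obtain K where K: "\<And>\<eta>. \<eta> \<in> gromov_boundary \<Longrightarrow> boundary_product e \<xi> \<eta> \<ge> ereal K \<Longrightarrow> \<eta> \<in> S"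
      using S \<xi> unfolding boundary_open_def by blast
    obtain L where L: "\<And>\<eta>. \<eta> \<in> gromov_boundary \<Longrightarrow> boundary_product e \<xi> \<eta> \<ge> ereal L \<Longrightarrow> \<eta> \<in> T"
      using T \<xi> unfolding boundary_open_def by blast
    have "\<eta> \<in> S \<inter> T"
      if "\<eta> \<in> gromov_boundary" "boundary_product e \<xi> \<eta> \<ge> ereal (max K L)" for \<eta>
    proof -
      have "ereal K \<le> boundary_product e \<xi> \<eta>" "ereal L \<le> boundary_product e \<xi> \<eta>"
        by (rule order_trans[OF _ that(2)], simp)+
      then show ?thesis using K[OF that(1)] L[OF that(1)] by (rule_tac IntI)
    qed
    then show "\<exists>K::real. \<forall>\<eta>\<in>gromov_boundary. boundary_product e \<xi> \<eta> \<ge> ereal K \<longrightarrow> \<eta> \<in> S \<inter> T"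
      by blast
  qed
next
  fix \<U> :: "(nat \<Rightarrow> 'a) set set set"
  assume U: "\<forall>U\<in>\<U>. boundary_open U"
  show "boundary_open (\<Union>\<U>)"
    unfolding boundary_open_def
  proof (intro conjI ballI allI)
    show "\<Union>\<U> \<subseteq> gromov_boundary" using U by (auto simp: boundary_open_def)
  next
    fix \<xi> :: "(nat \<Rightarrow> 'a) set" and e :: 'a assume "\<xi> \<in> \<Union>\<U>"
    then obtain V where V: "V \<in> \<U>" "\<xi> \<in> V" by blast
    obtain K :: real where
      "\<forall>\<eta>\<in>gromov_boundary. boundary_product e \<xi> \<eta> \<ge> ereal K \<longrightarrow> \<eta> \<in> V"
      using U V unfolding boundary_open_def by blast
    then show "\<exists>K::real. \<forall>\<eta>\<in>gromov_boundary. boundary_product e \<xi> \<eta> \<ge> ereal K \<longrightarrow> \<eta> \<in> \<Union>\<U>"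
      using V by blast
  qed
qed

section \<open>Groups acting on a hyperbolic space\<close>

text \<open>The homeomorphism of the boundary induced by the isometry \<open>\<phi> g\<close>.\<close>

definition boundary_action ::
    "('g \<Rightarrow> 'x \<Rightarrow> 'x) \<Rightarrow> 'g \<Rightarrow> (nat \<Rightarrow> 'x) set \<Rightarrow> (nat \<Rightarrow> 'x) set" where
  "boundary_action \<phi> g \<xi> = (\<lambda>u. \<phi> g \<circ> u) ` \<xi>"

definition isometric_action :: "('g, 'm) monoid_scheme \<Rightarrow> ('g \<Rightarrow> 'x::metric_space \<Rightarrow> 'x) \<Rightarrow> bool" where
  "isometric_action G \<phi> \<longleftrightarrow> group_action G UNIV \<phi> \<and>
     (\<forall>g\<in>carrier G. \<forall>x y. dist (\<phi> g x) (\<phi> g y) = dist x y)"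

definition properly_discontinuous ::
    "('g, 'm) monoid_scheme \<Rightarrow> ('g \<Rightarrow> 'x::metric_space \<Rightarrow> 'x) \<Rightarrow> bool" where
  "properly_discontinuous G \<phi> \<longleftrightarrow>
     (\<forall>C. compact C \<longrightarrow> finite {g \<in> carrier G. \<phi> g ` C \<inter> C \<noteq> {}})"

text \<open>\<open>group.ord G g = 0\<close> means that \<open>g\<close> has infinite order.\<close>

definition loxodromic ::
    "('g, 'm) monoid_scheme \<Rightarrow> ('g \<Rightarrow> 'x::metric_space \<Rightarrow> 'x) \<Rightarrow> 'g \<Rightarrow> bool" where
  "loxodromic G \<phi> g \<longleftrightarrow> g \<in> carrier G \<and> group.ord G g = 0 \<and>
     card {\<xi> \<in> gromov_boundary. boundary_action \<phi> g \<xi> = \<xi>} = 2"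

definition parabolic_subgroup ::
    "('g, 'm) monoid_scheme \<Rightarrow> ('g \<Rightarrow> 'x::metric_space \<Rightarrow> 'x) \<Rightarrow> 'g set \<Rightarrow> bool" where
  "parabolic_subgroup G \<phi> H \<longleftrightarrow> subgroup H G \<and> infinite H \<and>
     (\<exists>\<xi>\<in>gromov_boundary. \<forall>h\<in>H. boundary_action \<phi> h \<xi> = \<xi>) \<and>
     (\<forall>h\<in>H. \<not> loxodromic G \<phi> h)"

definition maximal_parabolic ::
    "('g, 'm) monoid_scheme \<Rightarrow> ('g \<Rightarrow> 'x::metric_space \<Rightarrow> 'x) \<Rightarrow> 'g set \<Rightarrow> bool" where
  "maximal_parabolic G \<phi> H \<longleftrightarrow> parabolic_subgroup G \<phi> H \<and>
     (\<forall>K. parabolic_subgroup G \<phi> K \<longrightarrow> H \<subseteq> K \<longrightarrow> K = H)"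

text \<open>A parabolic point is the fixed point of a parabolic subgroup; it is bounded if its
  stabilizer acts cocompactly on its complement in the boundary.\<close>

definition bounded_parabolic_point ::
    "('g, 'm) monoid_scheme \<Rightarrow> ('g \<Rightarrow> 'x::metric_space \<Rightarrow> 'x) \<Rightarrow> (nat \<Rightarrow> 'x) set \<Rightarrow> bool" where
  "bounded_parabolic_point G \<phi> \<xi> \<longleftrightarrow> \<xi> \<in> gromov_boundary \<and>
     (\<exists>H. parabolic_subgroup G \<phi> H \<and> (\<forall>h\<in>H. boundary_action \<phi> h \<xi> = \<xi>)) \<and>
     (\<exists>C. compactin boundary_topology C \<and>
        (\<Union>g\<in>stabilizer G (boundary_action \<phi>) \<xi>. boundary_action \<phi> g ` C) = gromov_boundary - {\<xi>})"

text \<open>The elements \<open>\<gamma> n\<close> are required to be distinct. This is automatic, up to passing to a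
  subsequence, if the boundary has at least three points; if it has exactly two points, it excludes
  constant sequences, which carry no dynamical information there.\<close>

definition conical_limit_point ::
    "('g, 'm) monoid_scheme \<Rightarrow> ('g \<Rightarrow> 'x::metric_space \<Rightarrow> 'x) \<Rightarrow> (nat \<Rightarrow> 'x) set \<Rightarrow> bool" where
  "conical_limit_point G \<phi> \<xi> \<longleftrightarrow> \<xi> \<in> gromov_boundary \<and>
     (\<exists>\<gamma>::nat \<Rightarrow> 'g. \<exists>a b. range \<gamma> \<subseteq> carrier G \<and> inj \<gamma> \<and> a \<noteq> b \<and>
        limitin boundary_topology (\<lambda>n. boundary_action \<phi> (\<gamma> n) \<xi>) a sequentially \<and>
        (\<forall>\<eta>\<in>gromov_boundary - {\<xi>}.
           limitin boundary_topology (\<lambda>n. boundary_action \<phi> (\<gamma> n) \<eta>) b sequentially))"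

section \<open>Relative hyperbolicity\<close>

text \<open>Bowditch's definition of \<open>G\<close> being hyperbolic relative to \<open>\<P>\<close>. The type \<open>'x\<close>, with the
  action \<open>\<phi>\<close>, is the hyperbolic space witnessing relative hyperbolicity, and its Gromov boundary
  with the induced action of \<open>G\<close> is the Bowditch boundary of \<open>(G, \<P>)\<close>, which up to equivariant
  homeomorphism does not depend on the witness. Bowditch's peripheral collection
  is closed under conjugation, whereas often only representatives are listed;
  comparing the conjugates of members of \<open>\<P>\<close> with the maximal parabolic subgroups
  covers both conventions. Proper path-metric spaces are geodesic (Hopf--Rinow).\<close>

definition relatively_hyperbolic ::
    "('g, 'm) monoid_scheme \<Rightarrow> 'g set set \<Rightarrow> ('g \<Rightarrow> 'x::metric_space \<Rightarrow> 'x) \<Rightarrow> bool" where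
  "relatively_hyperbolic G \<P> \<phi> \<longleftrightarrow>
     group G \<and>
     proper_space TYPE('x) \<and> geodesic_space TYPE('x) \<and> hyperbolic_space TYPE('x) \<and>
     isometric_action G \<phi> \<and> properly_discontinuous G \<phi> \<and>
     (\<forall>\<xi>\<in>gromov_boundary. conical_limit_point G \<phi> \<xi> \<or> bounded_parabolic_point G \<phi> \<xi>) \<and>
     {g <#\<^bsub>G\<^esub> P #>\<^bsub>G\<^esub> inv\<^bsub>G\<^esub> g |g P. g \<in> carrier G \<and> P \<in> \<P>} = {H. maximal_parabolic G \<phi> H} \<and>
     (\<forall>P\<in>\<P>. finitely_generated G P)"

end

theory Submission
  imports Defs
begin

text \<open>
  Why the theorem holds. Put \<open>a = t\<^sup>m\<close> and \<open>b = w\<^sup>m\<close> for a suitable \<open>m > 0\<close>, and let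
  \<open>b\<^sub>k = a\<^sup>k b a\<^sup>-\<^sup>k\<close>. Conjugation by \<open>a\<close> maps \<open>N\<close> into itself, so \<open>N\<close> contains every \<open>b\<^sub>k\<close> with
  \<open>k \<ge> 0\<close>. Conversely, an element of \<open>\<langle>a, b\<rangle>\<close> is a product of some \<open>b\<^sub>k\<close> and their inverses,
  followed by a power of \<open>a\<close>; if it lies in \<open>N\<close>, conjugating by a high power of \<open>a\<close> shows that this power of \<open>a\<close> lies
  in \<open>N\<close> and hence is trivial. So \<open>\<langle>a, b\<rangle> \<inter> N\<close> is contained in the increasing union of the
  subgroups \<open>\<langle>b\<^sub>k : \<bar>k\<bar> \<le> L\<rangle>\<close>. If it were finitely generated, a single \<open>L\<close> would do, and
  \<open>b\<^bsub>L+1\<^esub>\<close> would lie in \<open>\<langle>b\<^sub>k : \<bar>k\<bar> \<le> L\<rangle>\<close>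
  (\<open>ascending_intersection_not_finitely_generated\<close>).

  Ping-pong excludes this. It suffices to find a set \<open>U\<close> in the hyperbolic space such that
  nontrivial powers of \<open>b\<close> map the complement of \<open>U\<close> into \<open>U\<close>, the translates \<open>a\<^sup>k U\<close> are pairwise
  disjoint, and a base point \<open>e\<close> lies in none of them: then \<open>b\<^sub>l e \<in> a\<^sup>l U\<close>, whereas elements of the
  subgroup generated by the other \<open>b\<^sub>k\<close> move \<open>e\<close> into another translate or fix it
  (\<open>ping_pong\<close>, \<open>ping_pong_table_independent\<close>).
  The set of all \<open>x\<close> having a large Gromov product \<open>(x | w\<^sup>i e)\<^sub>e\<close> for some \<open>i\<close> works, provided that
  the products \<open>(t\<^sup>j e | w\<^sup>i e)\<^sub>e\<close> are bounded uniformly in \<open>i\<close> and \<open>j\<close> (\<open>ping_pong_table\<close>). This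
  bound says that no end of the axis of \<open>w\<close> is a limit point of \<open>\<langle>t\<rangle>\<close>.

  The bound is the geometric core (\<open>gp_axis_bounded\<close>). An isometry of infinite order in a discrete
  group that fixes two boundary points translates along the line joining them, so that the
  distance from \<open>e\<close> to \<open>w\<^sup>k e\<close> is \<open>\<tau> \<bar>k\<bar>\<close> up to a bounded error, with \<open>\<tau> > 0\<close>
  (\<open>loxodromic_linear_growth\<close>). If the products were unbounded, \<open>t\<close> would fix an end of that axis
  and hence move the points \<open>w\<^sup>n e\<close> on that side by a bounded amount. By discreteness two of the
  conjugates \<open>w\<^sup>-\<^sup>n t w\<^sup>n\<close> coincide, so \<open>t\<close> commutes with a power of \<open>w\<close>. Then the orbit of \<open>e\<close> under
  \<open>\<langle>t\<rangle>\<close> stays close to the axis, and discreteness gives \<open>t\<^sup>j = w\<^sup>i\<close> with \<open>j \<noteq> 0\<close>,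
  contradicting \<open>\<langle>t\<rangle> \<inter> N = {1}\<close> and the infinite order of \<open>t\<close>.
\<close>

section \<open>Gromov products\<close>

abbreviation gp :: "'x::metric_space \<Rightarrow> 'x \<Rightarrow> 'x \<Rightarrow> real" where
  "gp \<equiv> gromov_product"

lemma gp_commute: "gp b x y = gp b y x"
  by (simp add: gromov_product_def dist_commute)

lemma gp_nonneg: "0 \<le> gp b x y"
  using dist_triangle[of x y b] by (simp add: gromov_product_def dist_commute)

lemma gp_self [simp]: "gp b b x = 0"
  by (simp add: gromov_product_def)

lemma gp_le_dist: "gp b x y \<le> dist b y"
  using dist_triangle[of b x y] by (simp add: gromov_product_def dist_commute)

text \<open>In a tree this says that the branches from \<open>a\<close> and from \<open>b\<close> towards \<open>x\<close> meet in a point of the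
  segment joining \<open>a\<close> and \<open>b\<close>. It turns a small Gromov product seen from one end into a large one
  seen from the other.\<close>

lemma gp_split: "gp a x b + gp b x a = dist a b"
  by (simp add: gromov_product_def dist_commute field_simps)

lemma gp_move_base: "gp b x y \<le> gp c x y + dist b c"
  using dist_triangle[of b x c] dist_triangle[of b y c]
  by (simp add: gromov_product_def field_simps)

lemma gp_move_right: "gp b x y \<le> gp b x z + dist y z"
  using dist_triangle[of b y z] dist_triangle[of x z y]
  by (simp add: gromov_product_def dist_commute field_simps)

section \<open>Quasi-additive functions on the integers\<close>

text \<open>The slope \<open>\<tau>\<close> is the limit of \<open>\<beta> n / n\<close>. It is obtained as a common point of the intervals
  around \<open>\<beta> n / n\<close> of radius \<open>E / n\<close> for \<open>n > 0\<close>, which meet pairwise because \<open>\<beta> (m n)\<close> is close both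
  to \<open>m \<beta> n\<close> and to \<open>n \<beta> m\<close>. Passing to negative arguments costs another \<open>2 * E\<close>.\<close>

lemma quasi_additive_linear:
  fixes \<beta> :: "int \<Rightarrow> real"
  assumes qa: "\<And>m n. \<bar>\<beta> (m + n) - \<beta> m - \<beta> n\<bar> \<le> E"
  shows "\<exists>\<tau>. \<forall>n. \<bar>\<beta> n - \<tau> * of_int n\<bar> \<le> 3 * E"
proof -
  have E: "0 \<le> E" using qa[of 0 0] by linarith
  have mult: "\<bar>\<beta> (int (Suc k) * n) - real (Suc k) * \<beta> n\<bar> \<le> real k * E" for k n
  proof (induction k)
    case (Suc k)
    have "int (Suc (Suc k)) * n = int (Suc k) * n + n" by (simp add: algebra_simps)
    then show ?case using Suc qa[of "int (Suc k) * n" n] by (simp add: algebra_simps)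
  qed simp
  have mult': "\<bar>\<beta> (int k * n) - real k * \<beta> n\<bar> \<le> real k * E" if "k > 0" for k n
    using mult[of "k - 1" n] that E by (simp add: of_nat_diff algebra_simps)
  have cross: "(\<beta> (int n) - E) / n \<le> (\<beta> (int m) + E) / m" if "n > 0" "m > 0" for n m :: nat
  proof -
    have "real m * \<beta> (int n) - real n * \<beta> (int m) \<le> (real m + real n) * E"
      using mult'[OF that(1), of "int m"] mult'[OF that(2), of "int n"]
      by (simp add: algebra_simps)
    then show ?thesis using that by (simp add: field_simps)
  qed
  define \<tau> where "\<tau> = (SUP n\<in>{0<..}. (\<beta> (int n) - E) / real n)"
  have bdd: "bdd_above ((\<lambda>n. (\<beta> (int n) - E) / real n) ` {0<..})"
    by (rule bdd_aboveI2[where M = "(\<beta> (int 1) + E) / real 1"], rule cross) auto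
  have pos: "\<bar>\<beta> (int n) - \<tau> * real n\<bar> \<le> E" if "n > 0" for n
  proof -
    have "(\<beta> (int n) - E) / real n \<le> \<tau>"
      unfolding \<tau>_def by (rule cSUP_upper[OF _ bdd]) (use that in simp)
    moreover have "\<tau> \<le> (\<beta> (int n) + E) / real n"
      unfolding \<tau>_def by (rule cSUP_least) (use that cross in auto)
    ultimately show ?thesis using that by (simp add: field_simps)
  qed
  have "\<bar>\<beta> n - \<tau> * of_int n\<bar> \<le> 3 * E" for n
  proof -
    consider "n = 0" | "n > 0" | "n < 0" by linarith
    then show ?thesis
    proof cases
      case 1 then show ?thesis using qa[of 0 0] E by simp
    next
      case 2 then show ?thesis using pos[of "nat n"] E by simp
    next
      case 3
      then have "\<bar>\<beta> (- n) + \<tau> * of_int n\<bar> \<le> E" using pos[of "nat (- n)"] by simp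
      then show ?thesis using qa[of n "- n"] qa[of 0 0] by simp
    qed
  qed
  then show ?thesis by blast
qed

section \<open>Ping-pong\<close>

text \<open>The last argument is the index of the leading syllable. It is carried along so that consecutive
  syllables can be required to have different indices. Words are recorded by their values in the
  group, since only the action of these values matters.\<close>

inductive reduced_word :: "('g, 'm) monoid_scheme \<Rightarrow> ('i \<Rightarrow> 'g) \<Rightarrow> 'i set \<Rightarrow> 'g \<Rightarrow> 'i option \<Rightarrow> bool"
  for G (structure) and b I where
  empty: "reduced_word G b I \<one> None"
| syllable: "reduced_word G b I g c \<Longrightarrow> i \<in> I \<Longrightarrow> c \<noteq> Some i \<Longrightarrow> n \<noteq> (0::int)
     \<Longrightarrow> reduced_word G b I (b i [^] n \<otimes> g) (Some i)"

lemma (in group) reduced_word_closed: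
  assumes "reduced_word G b I g c" "\<And>i. i \<in> I \<Longrightarrow> b i \<in> carrier G"
  shows "g \<in> carrier G"
  using assms by induction auto

lemma (in group) reduced_word_mult_power:
  assumes g: "reduced_word G b I g c" and b: "\<And>i. i \<in> I \<Longrightarrow> b i \<in> carrier G" and i: "i \<in> I"
  shows "\<exists>c'. reduced_word G b I (b i [^] (n::int) \<otimes> g) c'"
proof (cases "n = 0")
  case True
  then show ?thesis using g reduced_word_closed[OF g b] by auto
next
  case n: False
  show ?thesis
  proof (cases "c = Some i")
    case False
    then show ?thesis using reduced_word.syllable[OF g i False n] by blast
  next
    case True
    with g obtain h d m where h: "g = b i [^] (m::int) \<otimes> h" "reduced_word G b I h d" "d \<noteq> Some i"
      by (auto elim: reduced_word.cases)
    have "b i [^] n \<otimes> g = b i [^] (n + m) \<otimes> h"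
      using h b i reduced_word_closed[OF h(2) b] by (simp add: int_pow_mult m_assoc)
    moreover have "\<exists>c'. reduced_word G b I (b i [^] (n + m) \<otimes> h) c'"
    proof (cases "n + m = 0")
      case True
      have "reduced_word G b I (b i [^] (n + m) \<otimes> h) d"
        unfolding True using h(2) reduced_word_closed[OF h(2) b] by simp
      then show ?thesis ..
    next
      case False
      show ?thesis using reduced_word.syllable[OF h(2) i h(3) False] ..
    qed
    ultimately show ?thesis by simp
  qed
qed

lemma (in group) generate_reduced_word:
  assumes b: "\<And>i. i \<in> I \<Longrightarrow> b i \<in> carrier G" and g: "g \<in> generate G (b ` I)"
  shows "\<exists>c. reduced_word G b I g c"
proof -
  have "b ` I \<subseteq> carrier G" using b by auto
  note closed = generate_in_carrier[OF this]
  have "\<exists>c'. reduced_word G b I (g \<otimes> h) c'" if "reduced_word G b I h c" for h c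
    using g that
  proof (induction arbitrary: h c rule: generate.induct)
    case one
    then show ?case using reduced_word_closed[OF one b] by auto
  next
    case (incl x)
    then obtain i where i: "i \<in> I" "x = b i" by blast
    then have "x = b i [^] (1::int)" using b by simp
    then show ?case using reduced_word_mult_power[OF incl(2) b i(1)] by simp
  next
    case (inv x)
    then obtain i where i: "i \<in> I" "x = b i" by blast
    then have "inv x = b i [^] (- 1::int)" using b[OF i(1)] by (simp only: int_pow_neg int_pow_1)
    then show ?case using reduced_word_mult_power[OF inv(2) b i(1), of "- 1"] by simp
  next
    case (eng x y)
    then obtain c' where c': "reduced_word G b I (y \<otimes> h) c'" by blast
    have "x \<otimes> y \<otimes> h = x \<otimes> (y \<otimes> h)"
      using closed eng reduced_word_closed[OF eng(5) b] by (simp add: m_assoc)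
    then show ?case using eng.IH(1)[OF c'] by simp
  qed
  from this[OF reduced_word.empty] show ?thesis
    using closed[OF g] by simp
qed

text \<open>A reduced word sends \<open>x0\<close> into the set belonging to its leading syllable: the rest of the
  word has put \<open>x0\<close> outside this set, and the leading syllable moves it inside.\<close>

lemma (in group_action) ping_pong:
  assumes b: "\<And>i. i \<in> I \<Longrightarrow> b i \<in> carrier G"
    and attract: "\<And>i n x. i \<in> I \<Longrightarrow> n \<noteq> (0::int) \<Longrightarrow> x \<in> E - U i \<Longrightarrow> \<phi> (b i [^] n) x \<in> U i"
    and disj: "\<And>i j. i \<in> I \<Longrightarrow> j \<in> I \<Longrightarrow> i \<noteq> j \<Longrightarrow> U i \<inter> U j = {}"
    and x0: "x0 \<in> E" "\<And>i. i \<in> I \<Longrightarrow> x0 \<notin> U i"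
    and g: "g \<in> generate G (b ` I)"
  shows "\<phi> g x0 \<in> insert x0 (\<Union>i\<in>I. U i)"
proof -
  interpret group G using group_hom by (rule group_hom.axioms(1))
  have "(case c of None \<Rightarrow> \<phi> g x0 = x0 | Some i \<Rightarrow> i \<in> I \<and> \<phi> g x0 \<in> U i)"
    if "reduced_word G b I g c" for g c
    using that
  proof induction
    case empty
    show ?case using fun_cong[OF id_eq_one, of x0] x0(1) by simp
  next
    case (syllable g c i n)
    have g: "g \<in> carrier G" by (rule reduced_word_closed[OF syllable(1) b])
    have "\<phi> g x0 \<notin> U i"
    proof (cases c)
      case None
      then show ?thesis using syllable.IH x0(2)[OF syllable(2)] by simp
    next
      case (Some j)
      then show ?thesis using syllable.IH disj[of j i] syllable(2,3) by auto
    qed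
    moreover have "\<phi> g x0 \<in> E" by (rule element_image[OF g x0(1) refl])
    ultimately have "\<phi> (b i [^] n) (\<phi> g x0) \<in> U i" using attract[OF syllable(2,4)] by simp
    then show ?case
      using composition_rule[OF x0(1) _ g, of "b i [^] n"] b[OF syllable(2)] syllable(2) by simp
  qed
  note word = this
  obtain c where "reduced_word G b I g c" using generate_reduced_word[OF b g] ..
  from word[OF this] show ?thesis by (cases c) auto
qed

section \<open>Subgroups mapped into themselves by a conjugation\<close>

context group
begin

lemma inv_cancel_left: "a \<in> carrier G \<Longrightarrow> x \<in> carrier G \<Longrightarrow> inv a \<otimes> (a \<otimes> x) = x"
  by (simp add: m_assoc[symmetric])

definition conj_by :: "'a \<Rightarrow> 'a \<Rightarrow> 'a" where
  "conj_by a x = a \<otimes> x \<otimes> inv a"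

lemma conj_by_closed [simp]: "a \<in> carrier G \<Longrightarrow> x \<in> carrier G \<Longrightarrow> conj_by a x \<in> carrier G"
  by (simp add: conj_by_def)

lemma conj_by_mult:
  "a \<in> carrier G \<Longrightarrow> x \<in> carrier G \<Longrightarrow> y \<in> carrier G \<Longrightarrow> conj_by a (x \<otimes> y) = conj_by a x \<otimes> conj_by a y"
  by (simp add: conj_by_def m_assoc inv_cancel_left)

lemma conj_by_hom: "a \<in> carrier G \<Longrightarrow> group_hom G G (conj_by a)"
  by unfold_locales (auto simp: hom_def conj_by_mult)

lemma conj_by_conj_by:
  "a \<in> carrier G \<Longrightarrow> b \<in> carrier G \<Longrightarrow> x \<in> carrier G \<Longrightarrow> conj_by a (conj_by b x) = conj_by (a \<otimes> b) x"
  by (simp add: conj_by_def m_assoc inv_mult_group)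

lemma conj_by_power_mem:
  assumes N: "subgroup N G" and a: "a \<in> carrier G" and "\<And>x. x \<in> N \<Longrightarrow> conj_by a x \<in> N" and x: "x \<in> N"
  shows "conj_by (a [^] int k) x \<in> N"
proof (induction k)
  case 0
  then show ?case using x subgroup.mem_carrier[OF N x] by (simp add: conj_by_def)
next
  case (Suc k)
  have "conj_by (a [^] int (Suc k)) x = conj_by a (conj_by (a [^] int k) x)"
    using int_pow_mult[OF a, of 1 "int k"] a subgroup.mem_carrier[OF N x]
    by (simp add: conj_by_conj_by)
  then show ?case using Suc assms by simp
qed

lemma conj_by_generate_translates:
  assumes a: "a \<in> carrier G" and b: "b \<in> carrier G"
    and x: "x \<in> generate G ((\<lambda>i. conj_by (a [^] i) b) ` A)"
  shows "conj_by (a [^] (k::int)) x \<in> generate G ((\<lambda>i. conj_by (a [^] i) b) ` (\<lambda>i. k + i) ` A)"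
proof -
  interpret c: group_hom G G "conj_by (a [^] k)" using a by (simp add: conj_by_hom)
  have "conj_by (a [^] k) ` (\<lambda>i. conj_by (a [^] i) b) ` A = (\<lambda>i. conj_by (a [^] i) b) ` (\<lambda>i. k + i) ` A"
    using a b by (auto simp: image_image conj_by_conj_by int_pow_mult)
  moreover have "(\<lambda>i. conj_by (a [^] i) b) ` A \<subseteq> carrier G" using a b by auto
  ultimately have "generate G ((\<lambda>i. conj_by (a [^] i) b) ` (\<lambda>i. k + i) ` A)
      = conj_by (a [^] k) ` generate G ((\<lambda>i. conj_by (a [^] i) b) ` A)"
    using c.generate_img[of "(\<lambda>i. conj_by (a [^] i) b) ` A"] by simp
  then show ?thesis using x by simp
qed

text \<open>Moving all powers of \<open>a\<close> to the right leaves a product of conjugates of \<open>b\<close> and its inverse by powers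
  of \<open>a\<close>.\<close>

lemma generate_pair_normal_form:
  assumes a: "a \<in> carrier G" and b: "b \<in> carrier G" and g: "g \<in> generate G {a, b}"
  shows "\<exists>L k. \<exists>x \<in> generate G ((\<lambda>i. conj_by (a [^] i) b) ` {- int L..int L}). g = x \<otimes> a [^] (k::int)"
    (is "\<exists>L k. \<exists>x \<in> ?W L. _")
proof -
  have W_carrier: "(\<lambda>i. conj_by (a [^] i) b) ` {- int L..int L} \<subseteq> carrier G" for L :: nat using a b by auto
  note W_closed = generate_in_carrier[OF W_carrier]
  have mono: "?W L \<subseteq> ?W M" if "L \<le> M" for L M :: nat
    by (rule mono_generate, rule image_mono) (use that in auto)
  have b0: "conj_by (a [^] (0::int)) b = b" using b by (simp add: conj_by_def)
  have b_in: "b \<in> ?W 0" using b0 by (auto intro!: generate.incl)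
  from g show ?thesis
  proof (induction rule: generate.induct)
    case one
    show ?case by (rule exI[of _ 0], rule exI[of _ 0], rule bexI[OF _ generate.one]) simp
  next
    case (incl h)
    then consider "h = a" | "h = b" by blast
    then show ?case
    proof cases
      case 1
      show ?thesis
        by (rule exI[of _ 0], rule exI[of _ 1], rule bexI[OF _ generate.one]) (use 1 a in simp)
    next
      case 2
      show ?thesis
        by (rule exI[of _ 0], rule exI[of _ 0], rule bexI[OF _ b_in]) (use 2 b in simp)
    qed
  next
    case (inv h)
    then consider "h = a" | "h = b" by blast
    then show ?case
    proof cases
      case 1
      show ?thesis
        by (rule exI[of _ 0], rule exI[of _ "- 1"], rule bexI[OF _ generate.one])
          (use 1 a in \<open>simp add: int_pow_neg\<close>)
    next
      case 2
      have "inv b \<in> ?W 0" by (rule generate_m_inv_closed[OF W_carrier b_in])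
      then show ?thesis
        by (intro exI[of _ 0] exI[of _ 0], rule_tac bexI) (use 2 b W_closed in simp_all)
    qed
  next
    case (eng h1 h2)
    then obtain L k x M l y where x: "x \<in> ?W L" "h1 = x \<otimes> a [^] (k::int)"
      and y: "y \<in> ?W M" "h2 = y \<otimes> a [^] (l::int)" by blast
    have xy: "x \<in> carrier G" "y \<in> carrier G" using W_closed x y by auto
    define K where "K = L + M + nat \<bar>k\<bar>"
    have "conj_by (a [^] k) y \<in> generate G ((\<lambda>i. conj_by (a [^] i) b) ` (\<lambda>i. k + i) ` {- int M..int M})"
      by (rule conj_by_generate_translates[OF a b y(1)])
    also have "\<dots> \<subseteq> ?W K"
      by (rule mono_generate, rule image_mono) (auto simp: K_def)
    finally have "x \<otimes> conj_by (a [^] k) y \<in> ?W K"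
      using x(1) mono[of L K] by (intro generate.eng) (auto simp: K_def)
    moreover have "h1 \<otimes> h2 = (x \<otimes> conj_by (a [^] k) y) \<otimes> a [^] (k + l)"
      using xy a unfolding x(2) y(2) conj_by_def
      by (simp add: m_assoc int_pow_mult inv_cancel_left)
    ultimately show ?case by blast
  qed
qed

text \<open>The intersection contains all conjugates of \<open>b\<close> by nonnegative powers of \<open>a\<close> and is contained
  in the union of the subgroups generated by the conjugates with exponents in \<open>[-L, L]\<close>. Finitely
  many generators would lie in a single one of these subgroups.\<close>

lemma ascending_intersection_not_finitely_generated:
  assumes N: "subgroup N G" and a: "a \<in> carrier G" and bN: "b \<in> N"
    and asc: "\<And>x. x \<in> N \<Longrightarrow> conj_by a x \<in> N"
    and triv: "\<And>k::int. a [^] k \<in> N \<Longrightarrow> a [^] k = \<one>"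
    and free: "\<And>L::nat. conj_by (a [^] (int L + 1)) b \<notin> generate G ((\<lambda>i. conj_by (a [^] i) b) ` {- int L..int L})"
  shows "\<not> finitely_generated G (generate G {a, b} \<inter> N)"
proof
  assume "finitely_generated G (generate G {a, b} \<inter> N)"
  then obtain S where S: "finite S" "S \<subseteq> carrier G" "generate G S = generate G {a, b} \<inter> N"
    by (auto simp: finitely_generated_def)
  have b: "b \<in> carrier G" using subgroup.mem_carrier[OF N bN] .
  define W where "W L = generate G ((\<lambda>i. conj_by (a [^] i) b) ` {- int L..int L})" for L
  have carr: "(\<lambda>i. conj_by (a [^] i) b) ` A \<subseteq> carrier G" for A :: "int set" using a b by auto
  have W_closed: "x \<in> carrier G" if "x \<in> W L" for x L
    using that generate_in_carrier[OF carr] unfolding W_def by blast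
  have mono: "W L \<subseteq> W M" if "L \<le> M" for L M :: nat
    unfolding W_def by (rule mono_generate, rule image_mono) (use that in auto)
  have conj_N: "conj_by (a [^] int k) x \<in> N" if "x \<in> N" for k x
    by (rule conj_by_power_mem[OF N a asc that])
  have "\<exists>L. g \<in> W L" if g: "g \<in> generate G {a, b} \<inter> N" for g
  proof -
    obtain L x k where x: "x \<in> W L" "g = x \<otimes> a [^] (k::int)"
      using generate_pair_normal_form[OF a b] g unfolding W_def by blast
    \<comment> \<open>Conjugating by \<open>a\<^sup>L\<close> makes all exponents in \<open>x\<close> nonnegative.\<close>
    have "conj_by (a [^] int L) x \<in> generate G ((\<lambda>i. conj_by (a [^] i) b) ` (\<lambda>i. int L + i) ` {- int L..int L})"
      using conj_by_generate_translates[OF a b] x(1) unfolding W_def .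
    also have "\<dots> \<subseteq> N"
    proof (rule generate_subgroup_incl[OF _ N])
      show "(\<lambda>i. conj_by (a [^] i) b) ` (\<lambda>i. int L + i) ` {- int L..int L} \<subseteq> N"
      proof (clarsimp simp only: image_subset_iff atLeastAtMost_iff)
        fix i assume "- int L \<le> i"
        then show "conj_by (a [^] (int L + i)) b \<in> N" using conj_N[OF bN, of "nat (int L + i)"] by simp
      qed
    qed
    finally have xN: "conj_by (a [^] int L) x \<in> N" .
    have ak: "conj_by (a [^] int L) (a [^] k) = a [^] k"
      using a by (simp add: conj_by_def int_pow_mult[symmetric] int_pow_neg[symmetric])
    have "conj_by (a [^] int L) x \<otimes> a [^] k \<in> N"
      using conj_N[of g L] g a W_closed[OF x(1)] unfolding x(2) by (simp add: conj_by_mult ak)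
    then have "inv (conj_by (a [^] int L) x) \<otimes> (conj_by (a [^] int L) x \<otimes> a [^] k) \<in> N"
      by (rule subgroup.m_closed[OF N subgroup.m_inv_closed[OF N xN]])
    then have "a [^] k \<in> N"
      using a subgroup.mem_carrier[OF N xN] by (simp add: inv_cancel_left)
    then have "a [^] k = \<one>" by (rule triv)
    then have "g = x" using x(2) W_closed[OF x(1)] by simp
    then show ?thesis using x(1) by blast
  qed
  moreover have "S \<subseteq> generate G {a, b} \<inter> N"
    unfolding S(3)[symmetric] by (auto intro: generate.incl)
  ultimately have "\<forall>s\<in>S. \<exists>L. s \<in> W L" by blast
  then obtain l where l: "\<And>s. s \<in> S \<Longrightarrow> s \<in> W (l s)" by (elim bchoice[elim_format] exE) blast
  obtain L where L: "\<And>s. s \<in> S \<Longrightarrow> l s \<le> L"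
    using finite_nat_set_iff_bounded_le[of "l ` S"] S(1) by auto
  have "S \<subseteq> W L"
  proof
    fix s assume "s \<in> S"
    then show "s \<in> W L" using mono[OF L] l by blast
  qed
  then have le: "generate G {a, b} \<inter> N \<subseteq> W L"
    unfolding S(3)[symmetric] W_def by (rule generate_subgroup_incl[OF _ generate_is_subgroup[OF carr]])
  have F: "subgroup (generate G {a, b}) G" using a b by (intro generate_is_subgroup) simp
  have aF: "a [^] k \<in> generate G {a, b}" for k :: int
    by (rule subgroup_int_pow_closed[OF F]) (simp add: generate.incl)
  have bF: "b \<in> generate G {a, b}" by (simp add: generate.incl)
  have "conj_by (a [^] (int L + 1)) b \<in> generate G {a, b}"
    unfolding conj_by_def
    by (intro subgroup.m_closed[OF F] subgroup.m_inv_closed[OF F] aF bF)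
  moreover have "conj_by (a [^] (int L + 1)) b \<in> N" using conj_N[OF bN, of "Suc L"] by (simp add: add.commute)
  ultimately have "conj_by (a [^] (int L + 1)) b \<in> W L" using le by (intro subsetD[OF le] IntI)
  then show False using free[of L] by (simp only: W_def)
qed

end

section \<open>Discrete actions on hyperbolic spaces\<close>

text \<open>The last assumption is the form in which discreteness is used: it follows from proper
  discontinuity and from the compactness of the balls around \<open>e\<close>.\<close>

locale discrete_hyperbolic_action = group_action G UNIV \<phi>
  for G (structure) and \<phi> :: "'g \<Rightarrow> 'x::metric_space \<Rightarrow> 'x" +
  fixes e :: 'x and \<delta> :: real
  assumes isometry: "\<And>g x y. g \<in> carrier G \<Longrightarrow> dist (\<phi> g x) (\<phi> g y) = dist x y"
    and hyp: "\<And>b x y z :: 'x. gp b x z \<ge> min (gp b x y) (gp b y z) - \<delta>"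
    and finite_returns: "\<And>R. finite {g \<in> carrier G. dist e (\<phi> g e) \<le> R}"
begin

sublocale group G
  using group_hom by (rule group_hom.axioms(1))

abbreviation pt :: "'g \<Rightarrow> int \<Rightarrow> 'x" where
  "pt w k \<equiv> \<phi> (w [^] k) e"

definition linear_growth :: "'g \<Rightarrow> real \<Rightarrow> real \<Rightarrow> bool" where
  "linear_growth w \<tau> C \<longleftrightarrow> (\<forall>k. \<bar>dist e (pt w k) - \<tau> * \<bar>of_int k\<bar>\<bar> \<le> C)"

lemma act_mult: "g \<in> carrier G \<Longrightarrow> h \<in> carrier G \<Longrightarrow> \<phi> (g \<otimes> h) x = \<phi> g (\<phi> h x)"
  by (rule composition_rule) auto

lemma act_one [simp]: "\<phi> \<one> x = x"
  using id_eq_one by (metis UNIV_I restrict_apply)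

lemma act_inv [simp]: "g \<in> carrier G \<Longrightarrow> \<phi> (inv g) (\<phi> g x) = x"
  by (metis act_mult act_one inv_closed l_inv)

lemma act_inv' [simp]: "g \<in> carrier G \<Longrightarrow> \<phi> g (\<phi> (inv g) x) = x"
  by (metis act_mult act_one inv_closed r_inv)

lemma gp_isometry: "g \<in> carrier G \<Longrightarrow> gp (\<phi> g b) (\<phi> g x) (\<phi> g y) = gp b x y"
  by (simp add: gromov_product_def isometry)

lemma hyp_nonneg: "0 \<le> \<delta>"
  using hyp[of e e e e] by simp

lemma hyp_cases:
  fixes b :: 'x
  shows "gp b x y \<le> gp b x z + \<delta> \<or> gp b y z \<le> gp b x z + \<delta>"
  using hyp[of b x y z] by linarith

lemma hyp4:
  fixes b :: 'x
  shows "min (gp b x y) (min (gp b y z) (gp b z v)) - 2 * \<delta> \<le> gp b x v"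
  using hyp[of b x y v] hyp[of b y z v] hyp_nonneg by linarith

lemma pt_add: "w \<in> carrier G \<Longrightarrow> pt w (i + j) = \<phi> (w [^] i) (pt w j)"
  by (simp add: int_pow_mult act_mult)

lemma dist_pt: "w \<in> carrier G \<Longrightarrow> dist (pt w i) (pt w j) = dist e (pt w (j - i))"
  using pt_add[of w i "j - i"] isometry[of "w [^] i" e] by simp

lemma linear_growth_dist:
  assumes "w \<in> carrier G" "linear_growth w \<tau> C"
  shows "\<bar>dist (pt w i) (pt w j) - \<tau> * \<bar>of_int (j - i)\<bar>\<bar> \<le> C"
  using assms by (simp only: dist_pt linear_growth_def)

lemma int_pow_inj:
  assumes "w \<in> carrier G" "ord w = 0" "w [^] (i::int) = w [^] j"
  shows "i = j"
  using assms by (simp add: int_pow_eq)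

lemma finite_small_powers:
  assumes "w \<in> carrier G" "ord w = 0"
  shows "finite {k. dist e (pt w k) \<le> R}"
proof (rule finite_imageD)
  show "finite ((\<lambda>k. w [^] k) ` {k. dist e (pt w k) \<le> R})"
    by (rule finite_subset[OF _ finite_returns[of R]]) (use assms in auto)
  show "inj_on (\<lambda>k. w [^] k) {k. dist e (pt w k) \<le> R}"
    using int_pow_inj[OF assms] by (auto intro: inj_onI)
qed

section \<open>Translation along an axis\<close>

lemma boundary_rel_sym: "(u, v) \<in> boundary_rel \<Longrightarrow> (v, u) \<in> boundary_rel"
  by (simp add: boundary_rel_def gp_commute)

lemma boundary_rel_eventually:
  "(u, v) \<in> boundary_rel \<Longrightarrow> eventually (\<lambda>n. R \<le> gp b (u n) (v n)) sequentially"
  by (simp add: boundary_rel_def filterlim_at_top)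

lemma boundary_rel_trans:
  fixes u v z :: "nat \<Rightarrow> 'x"
  assumes "(u, v) \<in> boundary_rel" "(v, z) \<in> boundary_rel"
  shows "(u, z) \<in> boundary_rel"
proof -
  have "eventually (\<lambda>n. R \<le> gp b (u n) (z n)) sequentially" for b R
    using boundary_rel_eventually[OF assms(1), of "R + \<delta>" b]
      boundary_rel_eventually[OF assms(2), of "R + \<delta>" b]
  proof eventually_elim
    case (elim n)
    then show ?case using hyp[of b "u n" "v n" "z n"] by linarith
  qed
  then show ?thesis using assms by (simp add: boundary_rel_def filterlim_at_top)
qed

lemma converges_at_infinity_D:
  "converges_at_infinity u \<Longrightarrow> \<exists>N. \<forall>m\<ge>N. \<forall>n\<ge>N. R \<le> gp b (u m) (u n)"
  unfolding converges_at_infinity_def filterlim_at_top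
  by (drule spec[of _ b], drule spec[of _ R]) (auto simp: eventually_prod_sequentially gp_commute)

lemma converges_at_infinity_refl:
  assumes "converges_at_infinity u"
  shows "(u, u) \<in> boundary_rel"
proof -
  have "eventually (\<lambda>n. R \<le> gp b (u n) (u n)) sequentially" for b R
    using converges_at_infinity_D[OF assms, of R b] by (auto simp: eventually_sequentially)
  then show ?thesis using assms by (simp add: boundary_rel_def filterlim_at_top)
qed

text \<open>An isometry fixing a boundary point maps any sequence representing it to an equivalent one.
  For a negative exponent \<open>k\<close>, the isometry \<open>w\<^sup>-\<^sup>k\<close> is applied to all three points of the Gromov
  product; this moves the base point, which the definition of equivalence allows.\<close>

lemma fixed_class_powers:
  assumes w: "w \<in> carrier G" and fixed: "boundary_action \<phi> w (boundary_rel `` {u}) = boundary_rel `` {u}"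
    and u: "converges_at_infinity u"
  shows "eventually (\<lambda>n. R \<le> gp b (u n) (\<phi> (w [^] (k::int)) (u n))) sequentially"
proof -
  have step: "\<phi> w \<circ> v \<in> boundary_rel `` {u}" if "v \<in> boundary_rel `` {u}" for v
    using that fixed unfolding boundary_action_def by blast
  have nat: "(\<lambda>n. \<phi> (w [^] int k) (u n)) \<in> boundary_rel `` {u}" for k
  proof (induction k)
    case 0
    then show ?case using converges_at_infinity_refl[OF u] by simp
  next
    case (Suc k)
    have "\<phi> (w [^] int (Suc k)) x = \<phi> w (\<phi> (w [^] int k) x)" for x
      using act_mult[of w "w [^] int k"] int_pow_mult[OF w, of 1 "int k"] w by simp
    then show ?case using step[OF Suc] by (simp add: o_def)
  qed
  have ev: "eventually (\<lambda>n. R \<le> gp b (u n) (\<phi> (w [^] int k) (u n))) sequentially" for k R b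
    using nat[of k] by (intro boundary_rel_eventually) auto
  show ?thesis
  proof (cases "k \<ge> 0")
    case True
    then show ?thesis using ev[where k = "nat k"] by simp
  next
    case False
    have eq: "gp b x (\<phi> (w [^] k) x) = gp (\<phi> (w [^] (-k)) b) x (\<phi> (w [^] (-k)) x)" for x
      using gp_isometry[of "w [^] (-k)" b x "\<phi> (w [^] k) x"] w
      by (simp add: int_pow_neg gp_commute)
    show ?thesis
      unfolding eq using ev[where k = "nat (-k)" and b = "\<phi> (w [^] (-k)) b"] False by simp
  qed
qed

text \<open>Distance differences to two far away points in the same direction agree, so that Busemann
  functions can be evaluated on any point far out in a sequence.\<close>

lemma horofunction_close:
  fixes x :: 'x
  assumes "dist x y \<le> gp x a b"
  shows "\<bar>(dist a x - dist a y) - (dist b x - dist b y)\<bar> \<le> 2 * \<delta>"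
proof -
  have "gp x b y \<le> dist x y" "gp x a y \<le> dist x y" by (rule gp_le_dist)+
  then have "\<bar>gp x a y - gp x b y\<bar> \<le> \<delta>"
    using hyp[where b = x and x = a and y = b and z = y] hyp[where b = x and x = b and y = a and z = y] assms
    by (simp add: gp_commute[of x b a])
  then show ?thesis by (simp add: gromov_product_def dist_commute abs_le_iff field_simps)
qed

text \<open>The assumptions say that \<open>p\<close> and \<open>q\<close> are close to any geodesic from \<open>u\<close> to \<open>v\<close>. Along a geodesic,
  the distance from \<open>u\<close> is a coordinate.\<close>

lemma line_distance:
  fixes p :: 'x
  assumes "gp p u v \<le> C" "gp q u v \<le> C"
  shows "dist p q \<le> \<bar>dist u q - dist u p\<bar> + 4 * C + 2 * \<delta>"
proof -
  have "0 \<le> C" using assms(1) gp_nonneg[of p u v] by linarith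
  consider "gp p u q \<le> C + \<delta>" | "gp p q v \<le> C + \<delta>"
    using hyp_cases[of p u q v] assms(1) by linarith
  then show ?thesis
  proof cases
    case 1
    then show ?thesis using \<open>0 \<le> C\<close> by (simp add: gromov_product_def dist_commute)
  next
    case 2
    then show ?thesis using assms(2) dist_triangle[of u v p] \<open>0 \<le> C\<close>
      by (simp add: gromov_product_def dist_commute)
  qed
qed

lemma separated_classes_bounded:
  fixes u v :: "nat \<Rightarrow> 'x"
  assumes u: "converges_at_infinity u" and v: "converges_at_infinity v"
    and "(u, v) \<notin> boundary_rel"
  shows "\<exists>C. eventually (\<lambda>n. gp e (u n) (v n) \<le> C) sequentially"
proof -
  obtain b R where "\<not> eventually (\<lambda>n. R \<le> gp b (u n) (v n)) sequentially"
    using assms unfolding boundary_rel_def filterlim_at_top by auto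
  then have freq: "\<exists>n\<ge>N. gp b (u n) (v n) < R" for N
    unfolding eventually_sequentially by (meson not_le)
  obtain N where N: "\<forall>m\<ge>N. \<forall>n\<ge>N. R + 2 * \<delta> \<le> gp b (u m) (u n)"
    using converges_at_infinity_D[OF u] by blast
  obtain M where M: "\<forall>m\<ge>M. \<forall>n\<ge>M. R + 2 * \<delta> \<le> gp b (v m) (v n)"
    using converges_at_infinity_D[OF v] by blast
  obtain i where i: "i \<ge> max M N" "gp b (u i) (v i) < R" using freq by blast
  have "gp e (u n) (v n) \<le> R + 2 * \<delta> + dist e b" if "n \<ge> max M N" for n
  proof -
    have "R + 2 * \<delta> \<le> gp b (u i) (u n)" "R + 2 * \<delta> \<le> gp b (v n) (v i)"
      using N M i that by auto
    then have "gp b (u n) (v n) \<le> R + 2 * \<delta>"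
      using hyp4[of b "u i" "u n" "v n" "v i"] i by linarith
    then show ?thesis using gp_move_base[of e "u n" "v n" b] by linarith
  qed
  then show ?thesis unfolding eventually_sequentially by blast
qed

text \<open>Let \<open>u\<close> and \<open>v\<close> represent the two fixed points. The points \<open>w\<^sup>k e\<close> stay close to the line from
  \<open>u\<close> to \<open>v\<close>, so their distance from \<open>e\<close> is the absolute value of the Busemann function at \<open>u\<close>, up
  to a bounded error. Since \<open>w\<close> fixes the class of \<open>u\<close>, this function is a quasi-homomorphism in
  \<open>k\<close> and hence almost linear. Its slope is not \<open>0\<close>, because infinitely many distinct elements
  cannot all move \<open>e\<close> by a bounded amount.\<close>

lemma loxodromic_linear_growth:
  assumes lox: "loxodromic G \<phi> w"
  shows "\<exists>\<tau>>0. \<exists>C. linear_growth w \<tau> C"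
proof -
  have w: "w \<in> carrier G" and ord: "ord w = 0" using lox by (auto simp: loxodromic_def)
  obtain \<xi> \<eta> where neq: "\<xi> \<noteq> \<eta>"
    and eq: "{\<xi> \<in> gromov_boundary. boundary_action \<phi> w \<xi> = \<xi>} = {\<xi>, \<eta>}"
    using lox unfolding loxodromic_def card_2_iff by auto
  have "\<xi> \<in> {\<xi> \<in> gromov_boundary. boundary_action \<phi> w \<xi> = \<xi>}"
    and "\<eta> \<in> {\<xi> \<in> gromov_boundary. boundary_action \<phi> w \<xi> = \<xi>}"
    unfolding eq by simp_all
  then have \<xi>: "\<xi> \<in> gromov_boundary" and \<eta>: "\<eta> \<in> gromov_boundary"
    and fixed: "boundary_action \<phi> w \<xi> = \<xi>" "boundary_action \<phi> w \<eta> = \<eta>" by simp_all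
  obtain u where u: "converges_at_infinity u" "\<xi> = boundary_rel `` {u}"
    using \<xi> unfolding gromov_boundary_def by (auto elim: quotientE)
  obtain v where v: "converges_at_infinity v" "\<eta> = boundary_rel `` {v}"
    using \<eta> unfolding gromov_boundary_def by (auto elim: quotientE)
  have "(u, v) \<notin> boundary_rel"
    using neq u v boundary_rel_sym boundary_rel_trans by blast
  then obtain C0 where C0: "eventually (\<lambda>n. gp e (u n) (v n) \<le> C0) sequentially"
    using separated_classes_bounded u v by blast
  have mu: "eventually (\<lambda>n. R \<le> gp b (u n) (\<phi> (w [^] (k::int)) (u n))) sequentially" for R b k
    using fixed_class_powers[OF w] fixed u by blast
  have mv: "eventually (\<lambda>n. R \<le> gp b (v n) (\<phi> (w [^] (k::int)) (v n))) sequentially" for R b k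
    using fixed_class_powers[OF w] fixed v by blast
  define C1 where "C1 = C0 + 2 * \<delta>"
  have near_line: "eventually (\<lambda>n. gp (pt w k) (u n) (v n) \<le> C1) sequentially" for k
    using C0 mu[where R = "C1 + 1" and b = "pt w k" and k = k] mv[where R = "C1 + 1" and b = "pt w k" and k = k]
  proof eventually_elim
    case (elim n)
    have "gp (pt w k) (\<phi> (w [^] k) (u n)) (\<phi> (w [^] k) (v n)) \<le> C0"
      using elim(1) w by (simp add: gp_isometry)
    then show ?case
      using hyp4[of "pt w k" "\<phi> (w [^] k) (u n)" "u n" "v n" "\<phi> (w [^] k) (v n)"] elim
      by (simp add: C1_def gp_commute)
  qed
  define \<beta> where "\<beta> n k = dist (u n) (pt w k) - dist (u n) e" for n k
  have \<beta>_dist: "eventually (\<lambda>n. \<bar>dist e (pt w k) - \<bar>\<beta> n k\<bar>\<bar> \<le> 4 * C1 + 2 * \<delta>) sequentially" for k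
    using near_line[of k] near_line[of 0]
  proof eventually_elim
    case (elim n)
    have "0 \<le> C1" using elim(1) gp_nonneg[of "pt w k" "u n" "v n"] by linarith
    moreover have "\<bar>\<beta> n k\<bar> \<le> dist e (pt w k)"
      using dist_triangle[of "u n" e "pt w k"] dist_triangle[of "u n" "pt w k" e]
      by (simp add: \<beta>_def dist_commute)
    moreover have "dist e (pt w k) \<le> \<bar>\<beta> n k\<bar> + 4 * C1 + 2 * \<delta>"
      using line_distance[of e "u n" "v n" C1 "pt w k"] elim by (simp add: \<beta>_def)
    ultimately show ?case using hyp_nonneg by linarith
  qed
  have \<beta>_add: "eventually (\<lambda>n. \<bar>\<beta> n (k + l) - \<beta> n k - \<beta> n l\<bar> \<le> 2 * \<delta>) sequentially" for k l
    using mu[where R = "dist e (pt w l)" and b = "pt w k" and k = k]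
  proof eventually_elim
    case (elim n)
    have "\<phi> (w [^] k) (pt w l) = pt w (k + l)" using w by (simp add: pt_add)
    then have *: "dist (\<phi> (w [^] k) (u n)) (pt w (k + l)) = dist (u n) (pt w l)"
      "dist (\<phi> (w [^] k) (u n)) (pt w k) = dist (u n) e"
      using isometry[of "w [^] k" "u n"] w by (metis int_pow_closed)+
    have "dist (pt w k) (pt w (k + l)) \<le> gp (pt w k) (u n) (\<phi> (w [^] k) (u n))"
      using elim w by (simp add: dist_pt)
    from horofunction_close[OF this] show ?case unfolding * by (simp add: \<beta>_def)
  qed
  have \<beta>_cauchy: "\<exists>N. \<forall>m\<ge>N. \<forall>n\<ge>N. \<bar>\<beta> m k - \<beta> n k\<bar> \<le> 2 * \<delta>" for k
  proof -
    obtain N where "\<forall>m\<ge>N. \<forall>n\<ge>N. dist (pt w k) e \<le> gp (pt w k) (u m) (u n)"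
      using converges_at_infinity_D[OF u(1)] by blast
    then show ?thesis using horofunction_close unfolding \<beta>_def by blast
  qed
  then obtain N where N: "\<And>k m n. m \<ge> N k \<Longrightarrow> n \<ge> N k \<Longrightarrow> \<bar>\<beta> m k - \<beta> n k\<bar> \<le> 2 * \<delta>" by metis
  \<comment> \<open>The Busemann function: \<open>\<beta> n k\<close> need not converge in \<open>n\<close>, but it is eventually constant up to \<open>2 * \<delta>\<close>.\<close>
  define B where "B k = \<beta> (N k) k" for k
  have B_ev: "eventually (\<lambda>n. \<bar>B k - \<beta> n k\<bar> \<le> 2 * \<delta>) sequentially" for k
    unfolding B_def eventually_sequentially using N by blast
  \<comment> \<open>A defect of \<open>2 * \<delta>\<close> from additivity and one from each of the three values of \<open>B\<close>.\<close>
  have "\<bar>B (k + l) - B k - B l\<bar> \<le> 8 * \<delta>" for k l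
  proof -
    have "eventually (\<lambda>n. \<bar>B (k + l) - B k - B l\<bar> \<le> 8 * \<delta>) sequentially"
      using B_ev[of "k + l"] B_ev[of k] B_ev[of l] \<beta>_add[of k l] by eventually_elim linarith
    then show ?thesis by simp
  qed
  then obtain \<tau> where \<tau>: "\<And>n. \<bar>B n - \<tau> * of_int n\<bar> \<le> 3 * (8 * \<delta>)"
    using quasi_additive_linear[of B "8 * \<delta>"] by blast
  have B_dist: "\<bar>dist e (pt w k) - \<bar>B k\<bar>\<bar> \<le> 4 * C1 + 4 * \<delta>" for k
  proof -
    have "eventually (\<lambda>n. \<bar>dist e (pt w k) - \<bar>B k\<bar>\<bar> \<le> 4 * C1 + 4 * \<delta>) sequentially"
      using B_ev[of k] \<beta>_dist[of k] by eventually_elim linarith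
    then show ?thesis by simp
  qed
  have growth: "linear_growth w \<bar>\<tau>\<bar> (4 * C1 + 28 * \<delta>)"
    unfolding linear_growth_def
  proof
    fix k
    define r where "r = \<tau> * of_int k"
    have "\<bar>\<bar>B k\<bar> - \<bar>r\<bar>\<bar> \<le> 3 * (8 * \<delta>)"
      using order_trans[OF abs_triangle_ineq3 \<tau>[of k]] by (simp only: r_def)
    then have "\<bar>dist e (pt w k) - \<bar>r\<bar>\<bar> \<le> 4 * C1 + 28 * \<delta>"
      using B_dist[of k] by linarith
    then show "\<bar>dist e (pt w k) - \<bar>\<tau>\<bar> * \<bar>of_int k\<bar>\<bar> \<le> 4 * C1 + 28 * \<delta>"
      by (simp only: r_def abs_mult)
  qed
  have "\<tau> \<noteq> 0"
  proof
    assume "\<tau> = 0"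
    then have "dist e (pt w k) \<le> 4 * C1 + 28 * \<delta>" for k
      using growth by (simp add: linear_growth_def)
    then have "{k. dist e (pt w k) \<le> 4 * C1 + 28 * \<delta>} = UNIV" by blast
    then show False
      using finite_small_powers[OF w ord, of "4 * C1 + 28 * \<delta>"] infinite_UNIV_int by simp
  qed
  with growth show ?thesis by (intro exI[of _ "\<bar>\<tau>\<bar>"]) auto
qed

section \<open>Orbits close to an axis\<close>

lemma linear_growth_nonneg: "linear_growth w \<tau> C \<Longrightarrow> 0 \<le> C"
  by (auto simp: linear_growth_def dest: spec[of _ 0])

lemma linear_growth_inv:
  assumes "w \<in> carrier G" "linear_growth w \<tau> C"
  shows "linear_growth (inv w) \<tau> C"
  unfolding linear_growth_def
proof
  fix k :: int
  show "\<bar>dist e (pt (inv w) k) - \<tau> * \<bar>of_int k\<bar>\<bar> \<le> C"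
    using assms(2)[unfolded linear_growth_def, rule_format, of "- k"] assms(1)
    by (simp add: int_pow_inv int_pow_neg)
qed

lemma axis_between:
  assumes w: "w \<in> carrier G" and lg: "linear_growth w \<tau> C" and "i \<le> j" "j \<le> k"
  shows "gp (pt w j) (pt w i) (pt w k) \<le> 3 / 2 * C"
  using linear_growth_dist[OF w lg, of j i] linear_growth_dist[OF w lg, of j k]
    linear_growth_dist[OF w lg, of i k] assms(3,4)
  by (simp add: gromov_product_def field_simps)

text \<open>Walk along the axis from \<open>w\<^sup>-\<^sup>M e\<close> to \<open>w\<^sup>M e\<close>. At each point, at least one of the two ends lies in a
  direction different from that of \<open>z\<close>; where this changes from the first end to the last, both
  do. Such a point of the axis is close to \<open>z\<close>. The walk has bounded steps, which replaces the
  continuity of a geodesic.\<close>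

lemma between_axis_points_near_axis:
  assumes w: "w \<in> carrier G" and lg: "linear_growth w \<tau> C" and M: "0 \<le> M"
    and z: "gp z (pt w (- M)) (pt w M) \<le> K"
  shows "\<exists>i. dist z (pt w i) \<le> 3 * C + 2 * \<delta> + 2 * dist e (pt w 1) + K"
proof -
  define a b where "a = pt w (- M)" and "b = pt w M"
  define s where "s = dist e (pt w 1)"
  define r where "r = 3 / 2 * C + \<delta>"
  have r: "0 \<le> r" using linear_growth_nonneg[OF lg] hyp_nonneg by (simp add: r_def)
  have split: "gp (pt w i) a z \<le> r \<or> gp (pt w i) b z \<le> r" if "- M \<le> i" "i \<le> M" for i
    using hyp_cases[of "pt w i" a z b] axis_between[OF w lg that]
    by (auto simp: a_def b_def r_def gp_commute[of _ z])
  define J where "J = {i \<in> {- M..M}. gp (pt w i) a z \<le> r}"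
  have J: "finite J" "- M \<in> J"
    using M r by (auto simp: J_def a_def intro: finite_subset[of _ "{- M..M}"])
  define i where "i = Max J"
  have i: "i \<in> J" unfolding i_def using J Max_in by blast
  have ia: "gp (pt w i) a z \<le> r" using i by (simp add: J_def)
  have ib: "gp (pt w i) b z \<le> r + s"
  proof (cases "i = M")
    case True
    then show ?thesis using r by (simp add: b_def s_def)
  next
    case False
    then have "i + 1 \<le> M" "- M \<le> i + 1" using i by (auto simp: J_def)
    moreover have "i + 1 \<notin> J" using Max_ge[OF J(1), of "i + 1"] by (auto simp: i_def)
    ultimately have "gp (pt w (i + 1)) b z \<le> r" using split[of "i + 1"] by (auto simp: J_def)
    then show ?thesis
      using gp_move_base[of "pt w i" b z "pt w (i + 1)"] dist_pt[OF w, of i "i + 1"] by (simp add: s_def)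
  qed
  have "0 \<le> s" by (simp add: s_def)
  then have "dist z (pt w i) \<le> 2 * r + 2 * s + K"
    using ia ib z dist_triangle[of a b "pt w i"] unfolding a_def[symmetric] b_def[symmetric]
    by (simp add: gromov_product_def dist_commute field_simps)
  then show ?thesis by (auto simp: r_def s_def)
qed

text \<open>The assumption \<open>unb\<close> says that the orbit of \<open>t\<close> comes arbitrarily close to the positive end of
  the axis. For given \<open>n\<close> choose \<open>j\<close> such that the direction from \<open>e\<close> to \<open>t\<^sup>j e\<close> follows the axis
  beyond \<open>w\<^sup>n e\<close>. Applying \<open>t\<close> moves both \<open>e\<close> and \<open>t\<^sup>j e\<close> only by the distance from \<open>e\<close> to \<open>t e\<close>, so
  \<open>t w\<^sup>n e\<close> lies in about the same direction from \<open>e\<close> as \<open>w\<^sup>n e\<close>, and at about the same distance.\<close>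

lemma shared_end_bounded_displacement:
  assumes w: "w \<in> carrier G" and t: "t \<in> carrier G" and lg: "linear_growth w \<tau> C" and \<tau>: "\<tau> > 0"
    and unb: "\<And>R. \<exists>j i. 0 \<le> i \<and> R \<le> gp e (pt t j) (pt w i)"
  shows "\<exists>D. \<forall>n\<ge>0. dist (pt w n) (\<phi> t (pt w n)) \<le> D"
proof -
  define s where "s = dist e (\<phi> t e)"
  have "dist (pt w n) (\<phi> t (pt w n)) \<le> 5 * C + 4 * \<delta> + 3 * s" if n: "0 \<le> n" for n
  proof -
    have C: "0 \<le> C" by (rule linear_growth_nonneg[OF lg])
    have len: "\<bar>dist e (pt w k) - \<tau> * of_int k\<bar> \<le> C" if "0 \<le> k" for k
      using lg[unfolded linear_growth_def, rule_format, of k] that by simp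
    obtain j i where i: "0 \<le> i" and ji: "\<tau> * of_int n + 2 * C \<le> gp e (pt t j) (pt w i)"
      using unb by blast
    have "\<tau> * of_int n \<le> \<tau> * of_int i"
      using ji gp_le_dist[of e "pt t j" "pt w i"] len[OF i] C by linarith
    then have ni: "n \<le> i" using \<tau> by simp
    have "dist (pt w n) (pt w i) \<le> \<tau> * of_int (i - n) + C"
      using linear_growth_dist[OF w lg, of n i] ni by simp
    then have "dist e (pt w n) - 5 / 2 * C \<le> gp e (pt w i) (pt w n)"
      using len[OF n] len[OF i] by (simp add: gromov_product_def dist_commute field_simps)
    then have near: "dist e (pt w n) - 5 / 2 * C - \<delta> \<le> gp e (pt t j) (pt w n)"
      using hyp[where b = e and x = "pt t j" and y = "pt w i" and z = "pt w n"] ji len[OF n] C by linarith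
    have t_pt: "pt t (j + 1) = \<phi> t (pt t j)" using pt_add[OF t, of 1 j] t by (simp add: add.commute)
    have "dist (pt t j) (\<phi> t (pt t j)) = s"
      using dist_pt[OF t, of j "j + 1"] t t_pt by (simp add: s_def)
    then have 1: "gp e (pt t j) (pt w n) - s \<le> gp e (pt w n) (\<phi> t (pt t j))"
      using gp_move_right[of e "pt w n" "pt t j" "\<phi> t (pt t j)"]
      by (simp add: gp_commute[of e _ "pt w n"])
    have 2: "gp e (pt t j) (pt w n) - s \<le> gp e (\<phi> t (pt t j)) (\<phi> t (pt w n))"
      using gp_move_base[of "\<phi> t e" "\<phi> t (pt t j)" "\<phi> t (pt w n)" e] t
      by (simp add: gp_isometry s_def dist_commute)
    have 3: "dist e (pt w n) - 5 / 2 * C - 2 * \<delta> - s \<le> gp e (pt w n) (\<phi> t (pt w n))"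
      using hyp[where b = e and x = "pt w n" and y = "\<phi> t (pt t j)" and z = "\<phi> t (pt w n)"] 1 2 near
      by linarith
    have "dist e (\<phi> t (pt w n)) \<le> s + dist e (pt w n)"
      using dist_triangle[of e "\<phi> t (pt w n)" "\<phi> t e"] isometry[OF t, of e "pt w n"] by (simp add: s_def)
    then show ?thesis using 3 by (simp add: gromov_product_def field_simps)
  qed
  then show ?thesis by blast
qed

text \<open>The conjugates \<open>w\<^sup>-\<^sup>n t w\<^sup>n\<close> with \<open>n \<ge> 0\<close> all move \<open>e\<close> by at most \<open>D\<close>, so two of them coincide.\<close>

lemma bounded_displacement_commutes:
  assumes w: "w \<in> carrier G" and t: "t \<in> carrier G"
    and D: "\<And>n. 0 \<le> n \<Longrightarrow> dist (pt w n) (\<phi> t (pt w n)) \<le> D"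
  shows "\<exists>q>0. w [^] (q::int) \<otimes> t = t \<otimes> w [^] q"
proof -
  define h where "h n = inv (w [^] n) \<otimes> t \<otimes> w [^] n" for n :: int
  have "h ` {0..} \<subseteq> {g \<in> carrier G. dist e (\<phi> g e) \<le> D}"
  proof (rule image_subsetI)
    fix n :: int assume n: "n \<in> {0..}"
    have "h n \<in> carrier G" using w t by (simp add: h_def)
    moreover    have "\<phi> (h n) e = \<phi> (inv (w [^] n)) (\<phi> t (pt w n))"
      using w t by (simp add: h_def act_mult)
    then have "dist e (\<phi> (h n) e) = dist (pt w n) (\<phi> t (pt w n))"
      using isometry[of "inv (w [^] n)" "pt w n" "\<phi> t (pt w n)"] w by simp
    then have "dist e (\<phi> (h n) e) \<le> D" using D n by simp
    ultimately show "h n \<in> {g \<in> carrier G. dist e (\<phi> g e) \<le> D}" by simp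
  qed
  then have "finite (h ` {0..})" by (rule finite_subset[OF _ finite_returns])
  then have "\<not> inj_on h {0..}" using infinite_Ici[of "0::int"] finite_imageD by blast
  then obtain m n where "m \<noteq> n" "h m = h n" unfolding inj_on_def by blast
  then obtain i p where ip: "i < p" "h i = h p" by (metis linorder_neqE)
  define q where "q = p - i"
  have "w [^] p = w [^] q \<otimes> w [^] i" using w by (simp add: q_def int_pow_mult[symmetric])
  then have "inv (w [^] i) \<otimes> t \<otimes> w [^] i = inv (w [^] i) \<otimes> (inv (w [^] q) \<otimes> t \<otimes> w [^] q) \<otimes> w [^] i"
    using ip(2) w t by (simp add: h_def inv_mult_group m_assoc)
  then have "t \<otimes> w [^] i = (inv (w [^] q) \<otimes> (t \<otimes> w [^] q)) \<otimes> w [^] i"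
    using w t by (simp add: m_assoc)
  then have "t = inv (w [^] q) \<otimes> (t \<otimes> w [^] q)"
    using w t by (subst (asm) right_cancel) auto
  then have "w [^] q \<otimes> t = t \<otimes> w [^] q"
    using w t by (metis inv_solve_left int_pow_closed m_closed)
  then show ?thesis using ip(1) by (intro exI[of _ q]) (simp add: q_def)
qed

lemma commuting_int_pow:
  assumes x: "x \<in> carrier G" and y: "y \<in> carrier G" and xy: "x \<otimes> y = y \<otimes> x"
  shows "x [^] (k::int) \<otimes> y = y \<otimes> x [^] k"
proof -
  interpret c: group_hom G G "conj_by y" using y by (rule conj_by_hom)
  have "conj_by y x = x" using x y by (simp add: conj_by_def flip: xy) (simp add: m_assoc)
  then have "conj_by y (x [^] k) = x [^] k" using c.hom_int_pow[OF x, of k] by simp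
  then show ?thesis using x y by (metis conj_by_def inv_solve_right int_pow_closed m_closed)
qed

text \<open>Since \<open>t\<^sup>j\<close> commutes with \<open>w\<^sup>q\<close>, it moves the points \<open>w\<^sup>q\<^sup>n e\<close> by an amount independent of \<open>n\<close> and thus
  fixes both ends of the axis. So, just as \<open>e\<close> lies between the two ends, \<open>t\<^sup>j e\<close> does, with the
  same bound for all \<open>j\<close>.\<close>

lemma commuting_orbit_near_axis:
  assumes w: "w \<in> carrier G" and t: "t \<in> carrier G" and lg: "linear_growth w \<tau> C" and \<tau>: "\<tau> > 0"
    and q: "q > 0" "w [^] (q::int) \<otimes> t = t \<otimes> w [^] q"
  shows "\<exists>D. \<forall>j. \<exists>i. dist (pt t j) (pt w i) \<le> D"
proof -
  define K where "K = 3 / 2 * C + 2 * \<delta>"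
  have "\<exists>i. dist (pt t j) (pt w i) \<le> 3 * C + 2 * \<delta> + 2 * dist e (pt w 1) + K" for j
  proof -
    define z d where "z = pt t j" and "d = dist e z"
    \<comment> \<open>\<open>w\<^sup>M e\<close> has to be so far out that its displacement \<open>d\<close> under \<open>t\<^sup>j\<close> is negligible.\<close>
    obtain n :: nat where n: "C + d + K + 1 < real n * \<tau>" using \<tau> reals_Archimedean3 by blast
    define M where "M = q * int n"
    have M0: "0 \<le> M" using q by (simp add: M_def)
    have "real n \<le> real_of_int M"
    proof -
      have "1 * int n \<le> q * int n" using q by (intro mult_right_mono) auto
      then show ?thesis unfolding M_def by linarith
    qed
    then have M: "C + d + K + 1 < \<tau> * of_int M"
      using n mult_right_mono[OF _ less_imp_le[OF \<tau>], of "real n" "of_int M"]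
      by (simp add: mult.commute[of \<tau>])
    have comm: "w [^] (q * k) \<otimes> t [^] j = t [^] j \<otimes> w [^] (q * k)" for k
    proof -
      have "w [^] (q * k) = (w [^] q) [^] k" using w by (simp add: int_pow_pow)
      then have "t \<otimes> w [^] (q * k) = w [^] (q * k) \<otimes> t"
        using commuting_int_pow[OF _ t q(2)] w by simp
      then show ?thesis using commuting_int_pow[OF t] w by simp
    qed
    have move: "\<phi> (t [^] j) (pt w k) = \<phi> (w [^] k) z" if "k \<in> {M, - M}" for k
    proof -
      have "k = q * int n \<or> k = q * (- int n)" using that by (auto simp: M_def)
      then obtain l where "k = q * l" by blast
      then show ?thesis using comm[of l] w t unfolding z_def by (metis act_mult int_pow_closed)
    qed
    have far: "K < gp z (\<phi> (t [^] j) (pt w k)) (pt w k)" if k: "k \<in> {M, - M}" for k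
    proof -
      have "dist (\<phi> (t [^] j) (pt w k)) (pt w k) = d"
        using isometry[of "w [^] k" z e] w by (simp add: move[OF k] d_def dist_commute)
      moreover have "dist z (\<phi> (t [^] j) (pt w k)) = dist e (pt w k)"
        using isometry[of "t [^] j" e "pt w k"] t by (simp add: z_def)
      moreover have "\<tau> * of_int M - C \<le> dist e (pt w k)"
        using lg[unfolded linear_growth_def, rule_format, of k] k M0 by auto
      moreover have "dist z (\<phi> (t [^] j) (pt w k)) \<le> dist z (pt w k) + dist (\<phi> (t [^] j) (pt w k)) (pt w k)"
        by (metis dist_triangle dist_commute)
      ultimately have "\<tau> * of_int M - C - d \<le> gp z (\<phi> (t [^] j) (pt w k)) (pt w k)"
        by (simp add: gromov_product_def)
      then show ?thesis using M by linarith
    qed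
    have "gp z (\<phi> (t [^] j) (pt w (- M))) (\<phi> (t [^] j) (pt w M)) = gp e (pt w (- M)) (pt w M)"
      unfolding z_def using t by (simp add: gp_isometry)
    also have "\<dots> \<le> 3 / 2 * C" using axis_between[OF w lg, of "- M" 0 M] M0 by simp
    finally have "gp z (pt w (- M)) (pt w M) \<le> K"
      using hyp4[of z "\<phi> (t [^] j) (pt w (- M))" "pt w (- M)" "pt w M" "\<phi> (t [^] j) (pt w M)"]
        far[of M] far[of "- M"] unfolding K_def by (simp add: gp_commute[of z "pt w M" "\<phi> (t [^] j) (pt w M)"])
    from between_axis_points_near_axis[OF w lg M0 this] show ?thesis unfolding z_def .
  qed
  then show ?thesis by blast
qed

lemma orbit_near_axis_common_power:
  assumes w: "w \<in> carrier G" and t: "t \<in> carrier G"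
    and D: "\<And>j. \<exists>i. dist (pt t j) (pt w i) \<le> D"
  shows "\<exists>j i. j \<noteq> 0 \<and> t [^] (j::int) = w [^] (i::int)"
proof -
  obtain i where i: "\<And>j. dist (pt t j) (pt w (i j)) \<le> D" using D by metis
  define h where "h j = inv (w [^] i j) \<otimes> t [^] j" for j :: int
  have "range h \<subseteq> {g \<in> carrier G. dist e (\<phi> g e) \<le> D}"
  proof safe
    fix j
    show "h j \<in> carrier G" using w t by (simp add: h_def)
    have "dist e (\<phi> (h j) e) = dist (pt w (i j)) (pt t j)"
      using isometry[of "inv (w [^] i j)" "pt w (i j)" "pt t j"] w t by (simp add: h_def act_mult)
    then show "dist e (\<phi> (h j) e) \<le> D" using i[of j] by (simp add: dist_commute)
  qed
  then have "finite (range h)" by (rule finite_subset[OF _ finite_returns])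
  then have "\<not> inj h" using infinite_UNIV_int finite_imageD by blast
  then obtain k l where kl: "k \<noteq> l" "h k = h l" unfolding inj_on_def by blast
  have "t [^] (k - l) = w [^] (i k - i l)"
  proof -
    have "t [^] k = w [^] i k \<otimes> (inv (w [^] i l) \<otimes> t [^] l)"
      using kl(2) w t unfolding h_def by (metis inv_solve_left int_pow_closed inv_closed m_closed)
    then show ?thesis using w t by (simp add: int_pow_diff m_assoc)
  qed
  then show ?thesis using kl(1) by (intro exI[of _ "k - l"] exI[of _ "i k - i l"]) simp
qed

text \<open>Each of the two ends of the axis is treated separately; the negative end of the axis of \<open>w\<close> is
  the positive end for the inverse of \<open>w\<close>.\<close>

lemma gp_axis_bounded:
  assumes w: "w \<in> carrier G" and t: "t \<in> carrier G" and lg: "linear_growth w \<tau> C" and \<tau>: "\<tau> > 0"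
    and indep: "\<And>j i. j \<noteq> 0 \<Longrightarrow> t [^] (j::int) \<noteq> w [^] (i::int)"
  shows "\<exists>R. \<forall>j i. gp e (pt t j) (pt w i) < R"
proof -
  have half: "\<exists>R. \<forall>j. \<forall>i\<ge>0. gp e (pt t j) (pt v i) < R"
    if v: "v \<in> carrier G" "linear_growth v \<tau> C"
      and ind: "\<And>j i. j \<noteq> 0 \<Longrightarrow> t [^] (j::int) \<noteq> v [^] (i::int)" for v
  proof (rule ccontr)
    assume "\<not> ?thesis"
    then have "\<exists>j i. 0 \<le> i \<and> R \<le> gp e (pt t j) (pt v i)" for R by (meson not_less)
    then obtain D where "\<And>n. 0 \<le> n \<Longrightarrow> dist (pt v n) (\<phi> t (pt v n)) \<le> D"
      using shared_end_bounded_displacement[OF v(1) t v(2) \<tau>] by blast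
    then obtain q where "q > 0" "v [^] (q::int) \<otimes> t = t \<otimes> v [^] q"
      using bounded_displacement_commutes[OF v(1) t] by blast
    then obtain D where "\<And>j. \<exists>i. dist (pt t j) (pt v i) \<le> D"
      using commuting_orbit_near_axis[OF v(1) t v(2) \<tau>] by blast
    then show False using orbit_near_axis_common_power[OF v(1) t] ind by blast
  qed
  have inv_pow: "inv w [^] i = w [^] (- i)" for i :: int using w by (simp add: int_pow_inv int_pow_neg)
  have "\<exists>R. \<forall>j. \<forall>i\<ge>0. gp e (pt t j) (pt w i) < R"
    by (rule half[OF w lg]) (rule indep)
  then obtain R1 where R1: "\<And>j i. 0 \<le> i \<Longrightarrow> gp e (pt t j) (pt w i) < R1" by blast
  have "\<exists>R. \<forall>j. \<forall>i\<ge>0. gp e (pt t j) (pt (inv w) i) < R"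
    by (rule half[OF inv_closed[OF w] linear_growth_inv[OF w lg]]) (simp only: inv_pow indep not_False_eq_True)
  then obtain R2 where R2: "\<And>j i. 0 \<le> i \<Longrightarrow> gp e (pt t j) (pt (inv w) i) < R2" by blast
  have "gp e (pt t j) (pt w i) < max R1 R2" for j i
  proof (cases "0 \<le> i")
    case True then show ?thesis using R1[OF True, of j] by simp
  next
    case False
    then show ?thesis using R2[of "- i" j] by (simp add: inv_pow)
  qed
  then show ?thesis by blast
qed

text \<open>Take for \<open>U\<close> the points seen from \<open>e\<close> in a direction that follows the axis of \<open>w\<close> for a length
  of at least \<open>R + \<delta>\<close>. Choose \<open>m\<close> so large that powers of \<open>w\<close> and of \<open>t\<close> with exponent a nonzero
  multiple of \<open>m\<close> move \<open>e\<close> by more than \<open>2 * (R + \<delta>)\<close>. If \<open>U\<close> met a translate of itself under such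
  a power \<open>g\<close> of \<open>t\<close>, then \<open>g e\<close> seen from \<open>e\<close>, or \<open>e\<close> seen from \<open>g e\<close>, would lie in the direction of
  a common point and hence follow the axis, or its translate, for a length of at least \<open>R\<close>.\<close>

lemma ping_pong_table:
  assumes w: "w \<in> carrier G" "ord w = 0" and t: "t \<in> carrier G" "ord t = 0"
    and R: "\<And>j i. gp e (pt t j) (pt w i) < R"
  shows "\<exists>U. \<exists>m::int. m > 0 \<and> (\<forall>k x. k \<noteq> 0 \<longrightarrow> x \<notin> U \<longrightarrow> \<phi> (w [^] (m * k)) x \<in> U) \<and>
    (\<forall>j. j \<noteq> 0 \<longrightarrow> U \<inter> \<phi> (t [^] (m * j)) ` U = {}) \<and> (\<forall>j. pt t j \<notin> U)"
proof -
  define S where "S = R + \<delta>"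
  define U where "U = {x. \<exists>i. S \<le> gp e x (pt w i)}"
  have "finite ({k. dist e (pt w k) \<le> 2 * S} \<union> {k. dist e (pt t k) \<le> 2 * S})"
    using finite_small_powers w t by simp
  then have "bdd_above (abs ` ({k. dist e (pt w k) \<le> 2 * S} \<union> {k. dist e (pt t k) \<le> 2 * S}))"
    by (intro bdd_above_finite finite_imageI)
  then obtain M where
    "\<forall>x \<in> abs ` ({k. dist e (pt w k) \<le> 2 * S} \<union> {k. dist e (pt t k) \<le> 2 * S}). x \<le> M"
    unfolding bdd_above_def by (elim exE)
  then have M: "\<bar>k\<bar> \<le> M" if "dist e (pt w k) \<le> 2 * S \<or> dist e (pt t k) \<le> 2 * S" for k
    using that by auto
  define m where "m = max M 0 + 1"
  have large: "2 * S < dist e (pt w (m * k))" "2 * S < dist e (pt t (m * k))" if "k \<noteq> 0" for k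
  proof -
    have "m * 1 \<le> m * \<bar>k\<bar>" using that by (intro mult_left_mono) (auto simp: m_def)
    moreover have "M < m" "0 < m" by (auto simp: m_def)
    ultimately have "M < m * \<bar>k\<bar>" by linarith
    then have "\<not> \<bar>m * k\<bar> \<le> M" using \<open>0 < m\<close> by (simp add: abs_mult)
    then show "2 * S < dist e (pt w (m * k))" "2 * S < dist e (pt t (m * k))" using M by force+
  qed
  have orbit: "pt t j \<notin> U" for j
  proof
    assume "pt t j \<in> U"
    then obtain i where "R + \<delta> \<le> gp e (pt t j) (pt w i)" by (auto simp: U_def S_def)
    then show False using R[of j i] hyp_nonneg by linarith
  qed
  have attract: "\<phi> (w [^] (m * k)) x \<in> U" if "k \<noteq> 0" "x \<notin> U" for k x
  proof -
    let ?g = "w [^] (m * k)"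
    have "gp e x (pt w (- (m * k))) < S" using that by (auto simp: U_def not_le)
    moreover have "gp (\<phi> ?g e) (\<phi> ?g x) e = gp e x (pt w (- (m * k)))"
      using gp_isometry[of ?g e x "pt w (- (m * k))"] w by (simp add: int_pow_neg)
    ultimately have "S \<le> gp e (\<phi> ?g x) (\<phi> ?g e)"
      using gp_split[of e "\<phi> ?g x" "\<phi> ?g e"] large(1)[OF that(1)] by linarith
    then show ?thesis by (auto simp: U_def)
  qed
  have disjoint: "U \<inter> \<phi> (t [^] (m * j)) ` U = {}" if "j \<noteq> 0" for j
  proof (rule ccontr)
    let ?g = "t [^] (m * j)"
    assume "U \<inter> \<phi> ?g ` U \<noteq> {}"
    then obtain y where y: "y \<in> U" "\<phi> ?g y \<in> U" by blast
    then obtain i l where i: "S \<le> gp e y (pt w i)" and l: "S \<le> gp e (\<phi> ?g y) (pt w l)"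
      by (auto simp: U_def)
    have "gp (\<phi> ?g e) (\<phi> ?g y) e = gp e y (pt t (- (m * j)))"
      using gp_isometry[of ?g e y "pt t (- (m * j))"] t by (simp add: int_pow_neg)
    then have "gp e (\<phi> ?g y) (\<phi> ?g e) + gp e y (pt t (- (m * j))) = dist e (\<phi> ?g e)"
      using gp_split[of e "\<phi> ?g y" "\<phi> ?g e"] by simp
    then consider "S \<le> gp e (\<phi> ?g y) (\<phi> ?g e)" | "S \<le> gp e y (pt t (- (m * j)))"
      using large(2)[of j] \<open>j \<noteq> 0\<close> by linarith
    then show False
    proof cases
      case 1
      then show False using hyp[where b = e and x = "pt t (m * j)" and y = "\<phi> ?g y" and z = "pt w l"] l R[of "m * j" l]
        by (simp add: S_def gp_commute[of e "pt t (m * j)" "\<phi> ?g y"])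
    next
      case 2
      then show False using hyp[where b = e and x = "pt t (- (m * j))" and y = y and z = "pt w i"] i R[of "- (m * j)" i]
        by (simp add: S_def gp_commute[of e "pt t (- (m * j))" y])
    qed
  qed
  show ?thesis
  proof (intro exI conjI)
    show "0 < m" by (simp add: m_def)
    show "\<forall>k x. k \<noteq> 0 \<longrightarrow> x \<notin> U \<longrightarrow> \<phi> (w [^] (m * k)) x \<in> U" using attract by blast
    show "\<forall>j. j \<noteq> 0 \<longrightarrow> U \<inter> \<phi> (t [^] (m * j)) ` U = {}" using disjoint by blast
    show "\<forall>j. pt t j \<notin> U" using orbit by blast
  qed
qed

lemma ping_pong_table_independent:
  assumes a: "a \<in> carrier G" and b: "b \<in> carrier G"
    and attract: "\<And>k x. k \<noteq> 0 \<Longrightarrow> x \<notin> U \<Longrightarrow> \<phi> (b [^] (k::int)) x \<in> U"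
    and disjoint: "\<And>j. j \<noteq> 0 \<Longrightarrow> U \<inter> \<phi> (a [^] (j::int)) ` U = {}"
    and base: "\<And>j. pt a j \<notin> U"
    and l: "l \<notin> I"
  shows "conj_by (a [^] (l::int)) b \<notin> generate G ((\<lambda>i. conj_by (a [^] i) b) ` I)"
proof
  assume gen: "conj_by (a [^] l) b \<in> generate G ((\<lambda>i. conj_by (a [^] i) b) ` I)"
  define V where "V i = \<phi> (a [^] i) ` U" for i :: int
  have e_V: "e \<notin> V i" for i
  proof
    assume "e \<in> V i"
    then obtain y where "y \<in> U" "e = \<phi> (a [^] i) y" by (auto simp: V_def)
    then have "pt a (- i) \<in> U" using a by (simp add: int_pow_neg)
    then show False using base by blast
  qed
  have V_disj: "V i \<inter> V j = {}" if "i \<noteq> j" for i j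
  proof (rule ccontr)
    assume "V i \<inter> V j \<noteq> {}"
    then obtain y z where yz: "y \<in> U" "z \<in> U" "\<phi> (a [^] i) y = \<phi> (a [^] j) z" by (auto simp: V_def)
    have "a [^] (j - i) = inv (a [^] i) \<otimes> a [^] j"
      using int_pow_mult[OF a, of "- i" j] a by (simp add: int_pow_neg)
    then have "\<phi> (a [^] (j - i)) z = y"
      using a by (simp add: act_mult yz(3)[symmetric])
    then have "y \<in> U \<inter> \<phi> (a [^] (j - i)) ` U" using yz by (metis IntI image_eqI)
    then show False using disjoint[of "j - i"] that by simp
  qed
  have V_attract: "\<phi> (conj_by (a [^] i) b [^] n) x \<in> V i" if "n \<noteq> (0::int)" "x \<notin> V i" for i n x
  proof -
    interpret c: group_hom G G "conj_by (a [^] i)" using a by (simp add: conj_by_hom)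
    have "\<phi> (inv (a [^] i)) x \<notin> U"
    proof
      assume "\<phi> (inv (a [^] i)) x \<in> U"
      then have "\<phi> (a [^] i) (\<phi> (inv (a [^] i)) x) \<in> V i" unfolding V_def by blast
      then show False using that a by simp
    qed
    then have "\<phi> (b [^] n) (\<phi> (inv (a [^] i)) x) \<in> U" using attract that by blast
    moreover have "conj_by (a [^] i) b [^] n = a [^] i \<otimes> b [^] n \<otimes> inv (a [^] i)"
      using c.hom_int_pow[OF b, of n] by (simp add: conj_by_def)
    ultimately show ?thesis using a b by (simp add: V_def act_mult)
  qed
  have "\<phi> (conj_by (a [^] l) b) e \<in> insert e (\<Union>i\<in>I. V i)"
    by (rule ping_pong[OF _ _ _ _ _ gen, where U = V]) (use a b V_attract V_disj e_V in auto)
  moreover have inV: "\<phi> (conj_by (a [^] l) b) e \<in> V l"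
    using V_attract[OF one_neq_zero e_V, of l] a b by simp
  ultimately consider "\<phi> (conj_by (a [^] l) b) e = e"
    | i where "i \<in> I" "\<phi> (conj_by (a [^] l) b) e \<in> V i" by auto
  then show False
  proof cases
    case 1
    then show False using inV e_V[of l] by simp
  next
    case (2 i)
    then have "i \<noteq> l" using l by auto
    then show False using V_disj[of i l] 2 inV by auto
  qed
qed

end

theorem theorem6p2:
  fixes G :: "('g, 'm) monoid_scheme" (structure)
    and \<P> :: "'g set set"
    and \<phi> :: "'g \<Rightarrow> 'x::metric_space \<Rightarrow> 'x"
    and N :: "'g set" and w t :: 'g
  assumes "group G"
    and "relatively_hyperbolic G \<P> \<phi>"
    and "subgroup N G" and "finitely_generated G N"
    and "w \<in> N" and "loxodromic G \<phi> w"
    and "t \<in> carrier G" and "group.ord G t = 0"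
    and "t <# N #> inv t \<subseteq> N"
    and "generate G {t} \<inter> N = {\<one>}"
  shows "\<not> FGIP G \<and>
         (\<exists>m::int. \<not> finitely_generated G (generate G {t [^] m, w [^] m} \<inter> N))"
proof -
  interpret group G by fact
  have "isometric_action G \<phi>" and pd: "properly_discontinuous G \<phi>"
    and proper: "proper_space TYPE('x)" and hs: "hyperbolic_space TYPE('x)"
    using assms(2) by (simp_all add: relatively_hyperbolic_def)
  then have ga: "group_action G UNIV \<phi>"
    and iso: "\<And>g x y. g \<in> carrier G \<Longrightarrow> dist (\<phi> g x) (\<phi> g y) = dist x y"
    by (auto simp: isometric_action_def)
  obtain \<delta> where \<delta>: "\<And>b x y z :: 'x. gp b x z \<ge> min (gp b x y) (gp b y z) - \<delta>"
    using hs unfolding hyperbolic_space_def by blast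
  \<comment> \<open>The base point is arbitrary.\<close>
  define e :: 'x where "e = undefined"
  have returns: "finite {g \<in> carrier G. dist e (\<phi> g e) \<le> R}" for R
  proof (rule finite_subset)
    show "finite {g \<in> carrier G. \<phi> g ` cball e R \<inter> cball e R \<noteq> {}}"
      using pd proper by (simp add: properly_discontinuous_def proper_space_def)
    show "{g \<in> carrier G. dist e (\<phi> g e) \<le> R} \<subseteq> {g \<in> carrier G. \<phi> g ` cball e R \<inter> cball e R \<noteq> {}}"
    proof
      fix g assume g: "g \<in> {g \<in> carrier G. dist e (\<phi> g e) \<le> R}"
      then have "0 \<le> R" using order_trans[OF zero_le_dist[of e "\<phi> g e"], of R] by simp
      then have "\<phi> g e \<in> \<phi> g ` cball e R \<inter> cball e R" using g by simp
      then show "g \<in> {g \<in> carrier G. \<phi> g ` cball e R \<inter> cball e R \<noteq> {}}" using g by auto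
    qed
  qed
  interpret discrete_hyperbolic_action G \<phi> e \<delta>
    using ga iso \<delta> returns by (simp add: discrete_hyperbolic_action_def discrete_hyperbolic_action_axioms_def)
  have N: "subgroup N G" and t: "t \<in> carrier G" "ord t = 0" by fact+
  have w: "w \<in> carrier G" "ord w = 0" using assms(6) by (auto simp: loxodromic_def)
  have asc: "conj_by t x \<in> N" if "x \<in> N" for x
    using assms(9) that by (force simp: l_coset_def r_coset_def conj_by_def)
  have powers_N: "w [^] k \<in> N" for k :: int using subgroup_int_pow_closed[OF N \<open>w \<in> N\<close>] .
  have triv: "t [^] k = \<one>" if "t [^] k \<in> N" for k :: int
    using assms(10) that generate_pow[OF t(1)] by blast
  have indep: "t [^] j \<noteq> w [^] i" if "j \<noteq> 0" for j i :: int
  proof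
    assume "t [^] j = w [^] i"
    then have "t [^] j = t [^] (0::int)" using triv[of j] powers_N by simp
    then show False using int_pow_inj[OF t] that by blast
  qed
  obtain \<tau> C where \<tau>: "\<tau> > 0" and lg: "linear_growth w \<tau> C"
    using loxodromic_linear_growth[OF assms(6)] by blast
  have "\<exists>R. \<forall>j i. gp e (pt t j) (pt w i) < R"
    by (rule gp_axis_bounded[OF w(1) t(1) lg \<tau>]) (rule indep)
  then obtain R where R: "\<And>j i. gp e (pt t j) (pt w i) < R" by blast
  obtain U and m :: int where m: "m > 0"
    and attract: "\<And>k x. k \<noteq> 0 \<Longrightarrow> x \<notin> U \<Longrightarrow> \<phi> (w [^] (m * k)) x \<in> U"
    and disjoint: "\<And>j. j \<noteq> 0 \<Longrightarrow> U \<inter> \<phi> (t [^] (m * j)) ` U = {}"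
    and base: "\<And>j. pt t j \<notin> U"
    using ping_pong_table[OF w t R] by auto
  define a b where "a = t [^] m" and "b = w [^] m"
  have ab: "a \<in> carrier G" "b \<in> carrier G" using t w by (auto simp: a_def b_def)
  have a_pow: "a [^] k = t [^] (m * k)" and b_pow: "b [^] k = w [^] (m * k)" for k :: int
    using t w by (simp_all add: a_def b_def int_pow_pow)
  have not_fg: "\<not> finitely_generated G (generate G {a, b} \<inter> N)"
  proof (rule ascending_intersection_not_finitely_generated[OF N ab(1)])
    show "b \<in> N" by (simp add: b_def powers_N)
    show "conj_by a x \<in> N" if "x \<in> N" for x
      using conj_by_power_mem[OF N t(1) asc that, of "nat m"] m by (simp add: a_def)
    show "a [^] k = \<one>" if "a [^] k \<in> N" for k :: int
      using that unfolding a_pow by (rule triv)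
    show "conj_by (a [^] (int L + 1)) b \<notin> generate G ((\<lambda>i. conj_by (a [^] i) b) ` {- int L..int L})" for L
    proof (rule ping_pong_table_independent[OF ab, where U = U])
      show "\<phi> (b [^] k) x \<in> U" if "k \<noteq> 0" "x \<notin> U" for k :: int and x
        unfolding b_pow by (rule attract[OF that])
      show "U \<inter> \<phi> (a [^] j) ` U = {}" if "j \<noteq> 0" for j :: int
        unfolding a_pow by (rule disjoint[OF that])
      show "pt a j \<notin> U" for j
        unfolding a_pow by (rule base)
    qed simp
  qed
  have "finitely_generated G (generate G {a, b})"
    unfolding finitely_generated_def
  proof (intro conjI exI[of _ "{a, b}"])
    show "subgroup (generate G {a, b}) G" using ab by (intro generate_is_subgroup) simp
  qed (use ab in simp_all)
  then have "\<not> FGIP G" using not_fg assms(4) unfolding FGIP_def by blast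
  moreover have "\<exists>m::int. \<not> finitely_generated G (generate G {t [^] m, w [^] m} \<inter> N)"
    using not_fg unfolding a_def b_def by (rule exI)
  ultimately show ?thesis ..
qed

end
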